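(* Consider the sparse additive model described in the context, where $J_0^c\neq\emptyset$. Assume that $f_j\in\mathcal F_{n_j}(s_j,R_j)$ for all $j\in J_0^c$. Let $\hat c_1,\dots,\hat c_d$ be the sparse additive MAP estimators (with parameter $\gamma>0$, priors $\pi_0,\pi_1,\dots,\pi_d$ and the corresponding complexity penalties $Pen_0$, $Pen_j$) of the vectors of discrete Fourier coefficients $c_1,\dots,c_d$, and let $\hat f$ be the resulting estimator of $f$. Assume that there exist constants $C_0,C_1>0$ such that 1. $\pi_0(h)\ge (h/d)^{C_0h}$ for $h=1,\dots,\lfloor d/e\rfloor$, and $\pi_0(d)\ge e^{-C_0d}$; 2. $e^{-C_1k}\le \pi_j(k)\le e^{-c(\gamma)k}$ for $k=1,\dots,(n_j-1)/2$ and $j=1,\dots,d$, where $c(\gamma)=8(\gamma+3/4)^2$. Then, for any $J_0^c\subseteq\{1,\dots,d\}$ with $|J_0^c|=d_0$ and all $\mathcal F_{n_j}(s_j,R_j)$, $j\in J_0^c$, $$\sup_{f_j\in\mathcal F_{n_j}(s_j,R_j),\ j\in J_0^c} AMSE(\hat f,f)\le C_1(\gamma)\max\left\{\sum_{j\in J_0^c}\min\left(N^{-\frac{2s_j}{2s_j+1}},\frac{n_j}{N}\right),\ \frac{d_0\ln(d/d_0)}{N}\right\},$$ where $C_1(\gamma)$ is some constant depending only on $\gamma$.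
   Context: **Model.** $n_1,\dots,n_d$ are odd, $N=\prod_{j=1}^d n_j$. One observes, for $i_j=0,\dots,n_j-1$, $j=1,\dots,d$, $$y(i_1/n_1,\dots,i_d/n_d)=a_0+\sum_{j\in J_0^c} f_j(i_j/n_j)+\epsilon(i_1/n_1,\dots,i_d/n_d),$$ with $\epsilon(\cdot)$ independent $\mathcal N(0,\sigma^2)$, $a_0\in\mathbb R$ unknown, and $f_j$ unknown functions with $\sum_{i=0}^{n_j-1}f_j(i/n_j)=0$. Here $J_0$ and $J_0^c=\{1,\dots,d\}\setminus J_0$ are the unknown sets of indices of zero and nonzero components respectively; $f_j=0$ for $j\in J_0$. Put $f(x_1,\dots,x_d)=a_0+\sum_{j=1}^d f_j(x_j)$. **Fourier coefficients.** With $I=\sqrt{-1}$, $c_{kj}=\frac1{n_j}\sum_{i=0}^{n_j-1}f_j(i/n_j)e^{2\pi I k i/n_j}$ for $|k|\le (n_j-1)/2$, so that $f_j(i/n_j)=\sum_{|k|\le (n_j-1)/2}c_{kj}e^{-2\pi I k i/n_j}$ and $c_{0j}=0$; $c_j$ is the vector of the $c_{kj}$. **Classes.** $\mathcal F_{n_j}(s_j,R_j)$ is the set of functions $f_j$ whose discrete Fourier coefficients satisfy $c_{0j}=0$ and $\sum_{|k|\le (n_j-1)/2}|c_{kj}|^2|k|^{2s_j}\le R_j^2$, where $s_j>1/2$ and $R_j<C_R$ for some constant $C_R>0$. **Priors.** $\pi_0$ is a prior distribution on the number $d_0\in\{0,1,\dots,d\}$ of nonzero vectors $c_j$, with $\pi_0(h)>0$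 for all $h$. For each $j$, $\pi_j$ is a prior distribution, positive on $\{1,\dots,(n_j-1)/2\}$, of the truncation cut-point $k_j$ of a nonzero $c_j$. **Sparse additive MAP estimator.** Let $\bar y_j(i/n_j)$ be the average of the $N/n_j$ observations whose $j$-th coordinate equals $i/n_j$, and $\xi_{kj}=\frac1{n_j}\sum_{i=0}^{n_j-1}\bar y_j(i/n_j)e^{2\pi I k i/n_j}$. Define $$Pen_0(h)=\frac{2\sigma^2}{N}\Big(1+\frac1\gamma\Big)\log\Big(\pi_0(h)^{-1}\binom dh\Big),\quad Pen_j(k)=\frac{2\sigma^2}{N}\Big(1+\frac1\gamma\Big)\log\big(\pi_j(k)^{-1}(1+\gamma)^k\big).$$ Let $\hat J\subseteq\{1,\dots,d\}$ and $\hat k_j\in\{1,\dots,(n_j-1)/2\}$, $j\in\hat J$, minimize over all $J'\subseteq\{1,\dots,d\}$ and all $k_j\in\{1,\dots,(n_j-1)/2\}$, $j\in J'$, $$\sum_{j\in J'}\Big\{-\sum_{1\le|k|\le k_j}|\xi_{kj}|^2+Pen_j(k_j)\Big\}+Pen_0(|J'|).$$ Set $\hat c_{kj}=\xi_{kj}$ if $j\in\hat J$ and $1\le|k|\le\hat k_j$, and $\hat c_{kj}=0$ otherwise; $\hat f_j(i/n_j)=\sum_{|k|\le (n_j-1)/2}\hat c_{kj}e^{-2\pi I k i/n_j}$; $\hat a_0$ is the mean of all $N$ observations; $\hat f(x_1,\dots,x_d)=\hat a_0+\sum_{j=1}^d\hat f_j(x_j)$. **Risk.** $AMSE(\hat f,f)=\frac1N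 E\|\hat f-f\|_N^2$, where $\|\cdot\|_N$ is the Euclidean norm of the vector of values at the $N$ lattice points.
   Formalization: The constant in the bound may depend on σ, C_0, C_1 and C_R besides γ (independence of them is false: AMSE ≥ σ²/N); π_j need only be positive on the cut-point range, not concentrated there; n_j ≥ 3 and R_j ≥ 0 are assumed. *)

theory Defs
  imports "HOL-Probability.Probability"
begin

text \<open>
  Lattice points are addressed by multi-indices \<open>i\<close> with \<open>i j < n j\<close> for \<open>j = 1, \<dots>, d\<close>; the
  point itself is \<open>grid_point n i\<close>. A data vector assigns a real to every multi-index.
\<close>

definition lattice :: "nat \<Rightarrow> (nat \<Rightarrow> nat) \<Rightarrow> (nat \<Rightarrow> nat) set" where
  "lattice d n = (\<Pi>\<^sub>E j\<in>{1..d}. {..<n j})"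

definition sample_size :: "nat \<Rightarrow> (nat \<Rightarrow> nat) \<Rightarrow> nat" where
  "sample_size d n = (\<Prod>j=1..d. n j)"

definition grid_point :: "(nat \<Rightarrow> nat) \<Rightarrow> (nat \<Rightarrow> nat) \<Rightarrow> nat \<Rightarrow> real" where
  "grid_point n i = (\<lambda>j. real (i j) / real (n j))"

definition additive_fun :: "nat \<Rightarrow> real \<Rightarrow> (nat \<Rightarrow> real \<Rightarrow> real) \<Rightarrow> (nat \<Rightarrow> real) \<Rightarrow> real" where
  "additive_fun d a0 f x = a0 + (\<Sum>j=1..d. f j (x j))"

text \<open>The joint law of independent \<open>N(0, \<sigma>\<^sup>2)\<close> errors at the lattice points.\<close>

definition noise_law :: "nat \<Rightarrow> (nat \<Rightarrow> nat) \<Rightarrow> real \<Rightarrow> ((nat \<Rightarrow> nat) \<Rightarrow> real) measure" where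
  "noise_law d n \<sigma> = (\<Pi>\<^sub>M i\<in>lattice d n. density lborel (\<lambda>x. ennreal (normal_density 0 \<sigma> x)))"

definition data_space :: "nat \<Rightarrow> (nat \<Rightarrow> nat) \<Rightarrow> ((nat \<Rightarrow> nat) \<Rightarrow> real) measure" where
  "data_space d n = (\<Pi>\<^sub>M i\<in>lattice d n. borel)"

definition observations ::
  "nat \<Rightarrow> (nat \<Rightarrow> nat) \<Rightarrow> real \<Rightarrow> (nat \<Rightarrow> real \<Rightarrow> real) \<Rightarrow> ((nat \<Rightarrow> nat) \<Rightarrow> real)
    \<Rightarrow> (nat \<Rightarrow> nat) \<Rightarrow> real" where
  "observations d n a0 f \<epsilon> = (\<lambda>i\<in>lattice d n. additive_fun d a0 f (grid_point n i) + \<epsilon> i)"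

definition dft :: "nat \<Rightarrow> (nat \<Rightarrow> real) \<Rightarrow> int \<Rightarrow> complex" where
  "dft m v k = (1 / of_nat m) *
     (\<Sum>i<m. of_real (v i) * exp (2 * of_real pi * \<i> * of_int k * of_nat i / of_nat m))"

definition fourier_coeff :: "nat \<Rightarrow> (real \<Rightarrow> real) \<Rightarrow> int \<Rightarrow> complex" where
  "fourier_coeff m g = dft m (\<lambda>i. g (real i / real m))"

definition sobolev_class :: "nat \<Rightarrow> real \<Rightarrow> real \<Rightarrow> (real \<Rightarrow> real) set" where
  "sobolev_class m s R = {g. fourier_coeff m g 0 = 0 \<and>
     (\<Sum>k | \<bar>k\<bar> \<le> (int m - 1) div 2.
        (cmod (fourier_coeff m g k))\<^sup>2 * real_of_int \<bar>k\<bar> powr (2 * s)) \<le> R\<^sup>2}"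

text \<open>
  The prior of a cut-point is only required to be positive on \<open>{1..(m - 1) div 2}\<close>, not to be
  concentrated there: a bound \<open>pmf p k \<le> exp (- c * k)\<close> on this whole range with
  \<open>c > ln 2\<close> forces it to have some of its mass elsewhere (for instance at \<open>0\<close>).
\<close>

definition cutpoint_prior :: "nat \<Rightarrow> nat pmf \<Rightarrow> bool" where
  "cutpoint_prior m p \<longleftrightarrow> (\<forall>k\<in>{1..(m - 1) div 2}. 0 < pmf p k)"

definition Pen0 ::
  "nat \<Rightarrow> (nat \<Rightarrow> nat) \<Rightarrow> real \<Rightarrow> real \<Rightarrow> nat pmf \<Rightarrow> nat \<Rightarrow> real" where
  "Pen0 d n \<sigma> \<gamma> \<pi>0 h = 2 * \<sigma>\<^sup>2 / real (sample_size d n) * (1 + 1 / \<gamma>) *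
     ln (inverse (pmf \<pi>0 h) * real (d choose h))"

definition Penj ::
  "nat \<Rightarrow> (nat \<Rightarrow> nat) \<Rightarrow> real \<Rightarrow> real \<Rightarrow> nat pmf \<Rightarrow> nat \<Rightarrow> real" where
  "Penj d n \<sigma> \<gamma> p k = 2 * \<sigma>\<^sup>2 / real (sample_size d n) * (1 + 1 / \<gamma>) *
     ln (inverse (pmf p k) * (1 + \<gamma>) ^ k)"

definition marginal_mean ::
  "nat \<Rightarrow> (nat \<Rightarrow> nat) \<Rightarrow> ((nat \<Rightarrow> nat) \<Rightarrow> real) \<Rightarrow> nat \<Rightarrow> nat \<Rightarrow> real" where
  "marginal_mean d n y j i =
     (\<Sum>l | l \<in> lattice d n \<and> l j = i. y l) / (real (sample_size d n) / real (n j))"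

definition xi ::
  "nat \<Rightarrow> (nat \<Rightarrow> nat) \<Rightarrow> ((nat \<Rightarrow> nat) \<Rightarrow> real) \<Rightarrow> nat \<Rightarrow> int \<Rightarrow> complex" where
  "xi d n y j = dft (n j) (marginal_mean d n y j)"

definition admissible :: "nat \<Rightarrow> (nat \<Rightarrow> nat) \<Rightarrow> nat set \<Rightarrow> (nat \<Rightarrow> nat) \<Rightarrow> bool" where
  "admissible d n J \<kappa> \<longleftrightarrow> J \<subseteq> {1..d} \<and> (\<forall>j\<in>J. \<kappa> j \<in> {1..(n j - 1) div 2})"

definition MAP_criterion ::
  "nat \<Rightarrow> (nat \<Rightarrow> nat) \<Rightarrow> real \<Rightarrow> real \<Rightarrow> nat pmf \<Rightarrow> (nat \<Rightarrow> nat pmf)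
    \<Rightarrow> ((nat \<Rightarrow> nat) \<Rightarrow> real) \<Rightarrow> nat set \<Rightarrow> (nat \<Rightarrow> nat) \<Rightarrow> real" where
  "MAP_criterion d n \<sigma> \<gamma> \<pi>0 \<pi> y J \<kappa> =
     (\<Sum>j\<in>J. - (\<Sum>k | 1 \<le> \<bar>k\<bar> \<and> \<bar>k\<bar> \<le> int (\<kappa> j). (cmod (xi d n y j k))\<^sup>2)
             + Penj d n \<sigma> \<gamma> (\<pi> j) (\<kappa> j))
     + Pen0 d n \<sigma> \<gamma> \<pi>0 (card J)"

text \<open>
  A MAP selection rule is a statistic, i.e. a measurable function of the data, that picks a
  minimizer for every data vector. The values of \<open>khat y j\<close> for \<open>j \<notin> Jhat y\<close> play no role.
\<close>

definition MAP_selection ::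
  "nat \<Rightarrow> (nat \<Rightarrow> nat) \<Rightarrow> real \<Rightarrow> real \<Rightarrow> nat pmf \<Rightarrow> (nat \<Rightarrow> nat pmf)
    \<Rightarrow> (((nat \<Rightarrow> nat) \<Rightarrow> real) \<Rightarrow> nat set) \<Rightarrow> (((nat \<Rightarrow> nat) \<Rightarrow> real) \<Rightarrow> nat \<Rightarrow> nat) \<Rightarrow> bool" where
  "MAP_selection d n \<sigma> \<gamma> \<pi>0 \<pi> Jhat khat \<longleftrightarrow>
     Jhat \<in> data_space d n \<rightarrow>\<^sub>M count_space (Pow {1..d}) \<and>
     (\<forall>j\<in>{1..d}. (\<lambda>y. khat y j) \<in> data_space d n \<rightarrow>\<^sub>M count_space UNIV) \<and>
     (\<forall>y\<in>space (data_space d n).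
        admissible d n (Jhat y) (khat y) \<and>
        (\<forall>J \<kappa>. admissible d n J \<kappa> \<longrightarrow>
           MAP_criterion d n \<sigma> \<gamma> \<pi>0 \<pi> y (Jhat y) (khat y) \<le> MAP_criterion d n \<sigma> \<gamma> \<pi>0 \<pi> y J \<kappa>))"

definition chat ::
  "nat \<Rightarrow> (nat \<Rightarrow> nat) \<Rightarrow> (((nat \<Rightarrow> nat) \<Rightarrow> real) \<Rightarrow> nat set)
    \<Rightarrow> (((nat \<Rightarrow> nat) \<Rightarrow> real) \<Rightarrow> nat \<Rightarrow> nat) \<Rightarrow> ((nat \<Rightarrow> nat) \<Rightarrow> real) \<Rightarrow> nat \<Rightarrow> int \<Rightarrow> complex" where
  "chat d n Jhat khat y j k =
     (if j \<in> Jhat y \<and> 1 \<le> \<bar>k\<bar> \<and> \<bar>k\<bar> \<le> int (khat y j) then xi d n y j k else 0)"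

text \<open>
  The Fourier synthesis is a complex number (with vanishing imaginary part, since
  \<open>xi d n y j (- k) = cnj (xi d n y j k)\<close>), so the estimator is kept complex-valued.
\<close>

definition fhat_component ::
  "nat \<Rightarrow> (nat \<Rightarrow> nat) \<Rightarrow> (((nat \<Rightarrow> nat) \<Rightarrow> real) \<Rightarrow> nat set)
    \<Rightarrow> (((nat \<Rightarrow> nat) \<Rightarrow> real) \<Rightarrow> nat \<Rightarrow> nat) \<Rightarrow> ((nat \<Rightarrow> nat) \<Rightarrow> real) \<Rightarrow> nat \<Rightarrow> nat \<Rightarrow> complex" where
  "fhat_component d n Jhat khat y j i =
     (\<Sum>k | \<bar>k\<bar> \<le> (int (n j) - 1) div 2.
        chat d n Jhat khat y j k * exp (- (2 * of_real pi * \<i> * of_int k * of_nat i / of_nat (n j))))"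

definition a0hat :: "nat \<Rightarrow> (nat \<Rightarrow> nat) \<Rightarrow> ((nat \<Rightarrow> nat) \<Rightarrow> real) \<Rightarrow> real" where
  "a0hat d n y = (\<Sum>i\<in>lattice d n. y i) / real (sample_size d n)"

definition fhat ::
  "nat \<Rightarrow> (nat \<Rightarrow> nat) \<Rightarrow> (((nat \<Rightarrow> nat) \<Rightarrow> real) \<Rightarrow> nat set)
    \<Rightarrow> (((nat \<Rightarrow> nat) \<Rightarrow> real) \<Rightarrow> nat \<Rightarrow> nat) \<Rightarrow> ((nat \<Rightarrow> nat) \<Rightarrow> real) \<Rightarrow> (nat \<Rightarrow> nat) \<Rightarrow> complex" where
  "fhat d n Jhat khat y i =
     of_real (a0hat d n y) + (\<Sum>j=1..d. fhat_component d n Jhat khat y j (i j))"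

text \<open>The risk takes values in \<open>[0, \<infinity>]\<close>, so that suprema of risks are always meaningful.\<close>

definition AMSE ::
  "nat \<Rightarrow> (nat \<Rightarrow> nat) \<Rightarrow> real \<Rightarrow> (((nat \<Rightarrow> nat) \<Rightarrow> real) \<Rightarrow> nat set)
    \<Rightarrow> (((nat \<Rightarrow> nat) \<Rightarrow> real) \<Rightarrow> nat \<Rightarrow> nat) \<Rightarrow> real \<Rightarrow> (nat \<Rightarrow> real \<Rightarrow> real) \<Rightarrow> ennreal" where
  "AMSE d n \<sigma> Jhat khat a0 f =
     (\<integral>\<^sup>+ \<epsilon>. ennreal ((1 / real (sample_size d n)) *
        (\<Sum>i\<in>lattice d n.
           (cmod (fhat d n Jhat khat (observations d n a0 f \<epsilon>) i
                  - of_real (additive_fun d a0 f (grid_point n i))))\<^sup>2))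
      \<partial>noise_law d n \<sigma>)"

text \<open>The components with index in \<open>J\<close> range over their classes; all others are zero.\<close>

definition sparse_functions ::
  "nat \<Rightarrow> (nat \<Rightarrow> nat) \<Rightarrow> (nat \<Rightarrow> real) \<Rightarrow> (nat \<Rightarrow> real) \<Rightarrow> nat set \<Rightarrow> (nat \<Rightarrow> real \<Rightarrow> real) set" where
  "sparse_functions d n s R J =
     {f. (\<forall>j\<in>J. f j \<in> sobolev_class (n j) (s j) (R j)) \<and> (\<forall>j\<in>{1..d} - J. f j = (\<lambda>_. 0))}"

end

theory Submission
  imports Defs
begin

text \<open>The selected model depends on the noise, so its fluctuation has to be controlled
  uniformly over all models, and the exponential moment that does this is finite only if the
  coefficient \<open>u\<close> of the squared standardized noise stays below \<open>1 / 2\<close>.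
  This shapes the constants. The value of \<open>t\<close> solves
  \<open>2 (1 + 1/\<gamma>) t = 1\<close>: it cancels the common factor of \<open>Pen0\<close> and
  \<open>Penj\<close>, so that exponentiating minus a penalty gives back the prior masses
  themselves. With factor 1 in front of the noise nothing of the loss would be left over; with
  \<open>1 + 1/\<gamma>\<close> the coefficient would be exactly \<open>1 / 2\<close>. The middle
  value \<open>1 + 1/(2 \<gamma>)\<close> gives \<open>u = t (1 + 1/(2 \<gamma>))\<close> with
  \<open>1 - 2 u = 1 / (2 (1 + \<gamma>))\<close>: the noise contributes
  \<open>2 (1 + \<gamma>)\<close> per unit of cut-point, of which \<open>Penj\<close> removes
  \<open>1 + \<gamma>\<close>. A second obstacle is that real data make the noise coefficients at
  \<open>k\<close> and \<open>-k\<close> conjugate, hence dependent; only sums over symmetric bands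
  behave like sums of independent squares.\<close>

text \<open>
  The waves \<open>chi\<close> together with the constant are orthogonal on the lattice, so the loss is the
  squared error of the constant plus the squared error of the Fourier coefficients, and the estimator
  is a penalized projection in a Gaussian sequence model. With \<open>z\<close> the noise coefficients, comparing
  the selected model \<open>M\<close> with a fixed competitor \<open>M\<^sub>0\<close> bounds the loss by bias and penalty of \<open>M\<^sub>0\<close>
  and by the fluctuation \<open>(1 + 1/(2\<gamma>)) \<parallel>z\<parallel>\<^sup>2 - Pen\<close> over \<open>M\<close>. Put \<open>t = \<gamma> / (2 (1 + \<gamma>))\<close>: then
  \<open>t N / \<sigma>\<^sup>2\<close> times the fluctuation over any model has exponential moment equal to the prior weight of
  that model times \<open>2\<^sup>k\<close> with \<open>k\<close> the sum of its cut-points. Since \<open>\<pi>\<^sub>j(k) \<le> 4\<^sup>-\<^sup>k\<close>, these moments add up to at most 1, so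
  the selected model costs only \<open>\<sigma>\<^sup>2 / (t N)\<close> in expectation.
\<close>

subsection \<open>Exponential moments of Gaussian quadratic forms\<close>

abbreviation gaussian :: "real \<Rightarrow> real measure" where
  "gaussian \<sigma> \<equiv> density lborel (\<lambda>x. ennreal (normal_density 0 \<sigma> x))"

lemma nn_integral_normal_density:
  assumes "\<sigma> > 0"
  shows "(\<integral>\<^sup>+x. ennreal (normal_density \<mu> \<sigma> x) \<partial>lborel) = 1"
proof -
  interpret prob_space "density lborel (\<lambda>x. ennreal (normal_density \<mu> \<sigma> x))"
    by (rule prob_space_normal_density[OF assms])
  show ?thesis using emeasure_space_1 by (simp add: emeasure_density)
qed

text \<open>Completing the square: tilting by \<open>exp (b * x)\<close> moves the mean to
  \<open>b * \<sigma>\<^sup>2\<close> and leaves the variance unchanged.\<close>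

lemma gaussian_exp_linear:
  assumes s: "\<sigma> > 0"
  shows "(\<integral>\<^sup>+x. ennreal (exp (b * x)) \<partial>gaussian \<sigma>) = ennreal (exp (\<sigma>\<^sup>2 * b\<^sup>2 / 2))"
proof -
  have e: "normal_density 0 \<sigma> x * exp (b * x)
      = exp (\<sigma>\<^sup>2 * b\<^sup>2 / 2) * normal_density (b * \<sigma>\<^sup>2) \<sigma> x" for x
  proof -
    have "-(x - 0)\<^sup>2 / (2 * \<sigma>\<^sup>2) + b * x = \<sigma>\<^sup>2 * b\<^sup>2 / 2 + -(x - b * \<sigma>\<^sup>2)\<^sup>2 / (2 * \<sigma>\<^sup>2)"
      using s by (simp add: field_simps power2_eq_square)
    then show ?thesis
      unfolding normal_density_def by (simp add: mult_exp_exp)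
  qed
  have "(\<integral>\<^sup>+x. ennreal (exp (b * x)) \<partial>gaussian \<sigma>)
      = (\<integral>\<^sup>+x. ennreal (normal_density 0 \<sigma> x) * ennreal (exp (b * x)) \<partial>lborel)"
    by (subst nn_integral_density) auto
  also have "\<dots> = (\<integral>\<^sup>+x. ennreal (exp (\<sigma>\<^sup>2 * b\<^sup>2 / 2)) * ennreal (normal_density (b * \<sigma>\<^sup>2) \<sigma> x) \<partial>lborel)"
    by (simp add: ennreal_mult[symmetric] e)
  also have "\<dots> = ennreal (exp (\<sigma>\<^sup>2 * b\<^sup>2 / 2))"
    using s by (simp add: nn_integral_cmult nn_integral_normal_density)
  finally show ?thesis .
qed

text \<open>The factor \<open>exp (u * x\<^sup>2)\<close> turns the standard normal density into
  \<open>r\<close> times the centred normal density with variance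
  \<open>r\<^sup>2 = 1 / (1 - 2 * u)\<close>.\<close>

lemma gaussian_exp_square:
  assumes u: "u < 1 / 2"
  shows "(\<integral>\<^sup>+x. ennreal (exp (u * x\<^sup>2)) \<partial>gaussian 1) = ennreal (1 / sqrt (1 - 2 * u))"
proof -
  define r where "r = 1 / sqrt (1 - 2 * u)"
  have r: "r > 0" "r\<^sup>2 = 1 / (1 - 2 * u)" using u by (auto simp: r_def power_divide)
  have e: "normal_density 0 1 x * exp (u * x\<^sup>2) = r * normal_density 0 r x" for x
  proof -
    have "-(x - 0)\<^sup>2 / (2 * 1\<^sup>2) + u * x\<^sup>2 = -(x - 0)\<^sup>2 / (2 * r\<^sup>2)"
      using u unfolding r by (simp add: field_simps power2_eq_square)
    moreover have "1 / sqrt (2 * pi * 1\<^sup>2) = r * (1 / sqrt (2 * pi * r\<^sup>2))"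
      using r(1) by (simp add: real_sqrt_mult)
    ultimately show ?thesis
      unfolding normal_density_def by (simp add: mult_exp_exp del: power_one)
  qed
  have "(\<integral>\<^sup>+x. ennreal (exp (u * x\<^sup>2)) \<partial>gaussian 1)
      = (\<integral>\<^sup>+x. ennreal (normal_density 0 1 x) * ennreal (exp (u * x\<^sup>2)) \<partial>lborel)"
    by (subst nn_integral_density) auto
  also have "\<dots> = (\<integral>\<^sup>+x. ennreal r * ennreal (normal_density 0 r x) \<partial>lborel)"
    using r(1) by (simp add: ennreal_mult[symmetric] e del: normal_density_def)
  also have "\<dots> = ennreal r"
    using r(1) by (simp add: nn_integral_cmult nn_integral_normal_density)
  finally show ?thesis by (simp add: r_def)
qed

lemma product_sigma_finite_gaussian:
  "\<sigma> > 0 \<Longrightarrow> product_sigma_finite (\<lambda>_. gaussian \<sigma>)"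
  by (simp add: product_sigma_finite_def prob_space_normal_density prob_space_imp_sigma_finite)

lemma prob_space_PiM_gaussian:
  "\<sigma> > 0 \<Longrightarrow> prob_space (\<Pi>\<^sub>M i\<in>I. gaussian \<sigma>)"
  by (intro prob_space_PiM prob_space_normal_density)

lemma nn_integral_PiM_gaussian_prod:
  assumes "\<sigma> > 0" and I: "finite I" and f: "\<And>i. i \<in> I \<Longrightarrow> f i \<in> borel_measurable borel"
    and "\<And>i x. i \<in> I \<Longrightarrow> f i x \<ge> 0"
  shows "(\<integral>\<^sup>+\<omega>. ennreal (\<Prod>i\<in>I. f i (\<omega> i)) \<partial>(\<Pi>\<^sub>M i\<in>I. gaussian \<sigma>))
      = (\<Prod>i\<in>I. \<integral>\<^sup>+x. ennreal (f i x) \<partial>gaussian \<sigma>)"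
proof -
  interpret product_sigma_finite "\<lambda>_. gaussian \<sigma>"
    by (rule product_sigma_finite_gaussian) fact
  have "(\<integral>\<^sup>+\<omega>. ennreal (\<Prod>i\<in>I. f i (\<omega> i)) \<partial>(\<Pi>\<^sub>M i\<in>I. gaussian \<sigma>))
     = (\<integral>\<^sup>+\<omega>. (\<Prod>i\<in>I. ennreal (f i (\<omega> i))) \<partial>(\<Pi>\<^sub>M i\<in>I. gaussian \<sigma>))"
    using assms(4) by (simp add: prod_ennreal)
  also have "\<dots> = (\<Prod>i\<in>I. \<integral>\<^sup>+x. ennreal (f i x) \<partial>gaussian \<sigma>)"
    by (rule product_nn_integral_prod[OF I]) (use f in simp)
  finally show ?thesis .
qed

lemma PiM_gaussian_exp_linear:
  assumes s: "\<sigma> > 0" and I: "finite I"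
  shows "(\<integral>\<^sup>+\<omega>. ennreal (exp (\<Sum>i\<in>I. b i * \<omega> i)) \<partial>(\<Pi>\<^sub>M i\<in>I. gaussian \<sigma>))
      = ennreal (exp (\<sigma>\<^sup>2 / 2 * (\<Sum>i\<in>I. (b i)\<^sup>2)))"
proof -
  have "(\<integral>\<^sup>+\<omega>. ennreal (exp (\<Sum>i\<in>I. b i * \<omega> i)) \<partial>(\<Pi>\<^sub>M i\<in>I. gaussian \<sigma>))
      = (\<Prod>i\<in>I. \<integral>\<^sup>+x. ennreal (exp (b i * x)) \<partial>gaussian \<sigma>)"
    using nn_integral_PiM_gaussian_prod[OF s I, of "\<lambda>i x. exp (b i * x)"] I
    by (simp add: exp_sum)
  also have "\<dots> = ennreal (\<Prod>i\<in>I. exp (\<sigma>\<^sup>2 * (b i)\<^sup>2 / 2))"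
    by (simp add: gaussian_exp_linear[OF s] prod_ennreal)
  also have "(\<Prod>i\<in>I. exp (\<sigma>\<^sup>2 * (b i)\<^sup>2 / 2)) = exp (\<sigma>\<^sup>2 / 2 * (\<Sum>i\<in>I. (b i)\<^sup>2))"
    using I by (simp add: exp_sum sum_distrib_left)
  finally show ?thesis .
qed

text \<open>Linearizing the square by an independent Gaussian vector \<open>g\<close>, that is
  \<open>exp (u v\<^sup>2) = E exp (sqrt (2 u) g v)\<close>, and exchanging the integrals avoids any appeal to the rotation
  invariance of the Gaussian measure.\<close>

lemma PiM_gaussian_exp_quadratic:
  fixes A :: "'t \<Rightarrow> 'i \<Rightarrow> real"
  assumes s: "\<sigma> > 0" and I: "finite I" and T: "finite T" and u: "0 \<le> u" "u < 1 / 2"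
    and orth: "\<And>t t'. t \<in> T \<Longrightarrow> t' \<in> T \<Longrightarrow>
      \<sigma>\<^sup>2 * (\<Sum>i\<in>I. A t i * A t' i) = (if t = t' then 1 else 0)"
  shows "(\<integral>\<^sup>+\<omega>. ennreal (exp (u * (\<Sum>t\<in>T. (\<Sum>i\<in>I. A t i * \<omega> i)\<^sup>2))) \<partial>(\<Pi>\<^sub>M i\<in>I. gaussian \<sigma>))
      = ennreal ((1 / sqrt (1 - 2 * u)) ^ card T)"
proof -
  define P where "P = (\<Pi>\<^sub>M i\<in>I. gaussian \<sigma>)"
  define Q where "Q = (\<Pi>\<^sub>M t\<in>T. gaussian 1)"
  interpret P: prob_space P unfolding P_def by (rule prob_space_PiM_gaussian[OF s])
  interpret Q: prob_space Q unfolding Q_def by (rule prob_space_PiM_gaussian) simp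
  interpret pair_sigma_finite P Q ..
  define v where "v = sqrt (2 * u)"
  have v: "v\<^sup>2 = 2 * u" using u by (simp add: v_def)
  \<comment> \<open>Bilinear in the two Gaussian vectors: integrating out \<open>g\<close> gives the
    quadratic form, integrating out \<open>\<omega>\<close> first gives a product over
    \<open>T\<close>.\<close>
  define B where "B = (\<lambda>\<omega> g. \<Sum>t\<in>T. \<Sum>i\<in>I. v * A t i * \<omega> i * g t :: real)"
  have meas: "(\<lambda>\<omega>. \<omega> i) \<in> borel_measurable P" if "i \<in> I" for i
    using measurable_component_singleton[OF that, of "\<lambda>_. gaussian \<sigma>"] by (simp add: P_def)
  have meas': "(\<lambda>g. g t) \<in> borel_measurable Q" if "t \<in> T" for t
    using measurable_component_singleton[OF that, of "\<lambda>_. gaussian 1"] by (simp add: Q_def)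
  have [measurable]: "(\<lambda>(\<omega>, g). ennreal (exp (B \<omega> g))) \<in> borel_measurable (P \<Otimes>\<^sub>M Q)"
  proof -
    have "(\<lambda>x. v * A t i * fst x i * snd x t) \<in> borel_measurable (P \<Otimes>\<^sub>M Q)"
      if "t \<in> T" "i \<in> I" for t i
      using measurable_compose[OF measurable_fst meas[OF that(2)], of Q]
        measurable_compose[OF measurable_snd meas'[OF that(1)], of P] by measurable
    then have "(\<lambda>x. B (fst x) (snd x)) \<in> borel_measurable (P \<Otimes>\<^sub>M Q)"
      unfolding B_def by (intro borel_measurable_sum)
    then show ?thesis by (simp add: case_prod_beta')
  qed
  have inner: "(\<integral>\<^sup>+g. ennreal (exp (B \<omega> g)) \<partial>Q)
      = ennreal (exp (u * (\<Sum>t\<in>T. (\<Sum>i\<in>I. A t i * \<omega> i)\<^sup>2)))" for \<omega>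
  proof -
    have "B \<omega> g = (\<Sum>t\<in>T. (v * (\<Sum>i\<in>I. A t i * \<omega> i)) * g t)" for g
      unfolding B_def by (simp add: sum_distrib_left sum_distrib_right mult.assoc)
    then show ?thesis
      unfolding Q_def using PiM_gaussian_exp_linear[OF zero_less_one T]
      by (simp add: power_mult_distrib v sum_distrib_left[symmetric])
  qed
  \<comment> \<open>For fixed \<open>g\<close> the exponent is linear in \<open>\<omega>\<close>,
    and by orthonormality of the rows of \<open>A\<close> its variance is \<open>2 * u\<close> times
    the squared length of \<open>g\<close>.\<close>
  have outer: "(\<integral>\<^sup>+\<omega>. ennreal (exp (B \<omega> g)) \<partial>P) = ennreal (\<Prod>t\<in>T. exp (u * (g t)\<^sup>2))" for g
  proof -
    have eq: "B \<omega> g = (\<Sum>i\<in>I. (v * (\<Sum>t\<in>T. A t i * g t)) * \<omega> i)" for \<omega>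
      unfolding B_def by (subst sum.swap) (simp add: sum_distrib_left sum_distrib_right mult_ac)
    have "\<sigma>\<^sup>2 * (\<Sum>i\<in>I. (\<Sum>t\<in>T. A t i * g t)\<^sup>2)
        = \<sigma>\<^sup>2 * (\<Sum>i\<in>I. \<Sum>t\<in>T. \<Sum>t'\<in>T. g t * g t' * (A t i * A t' i))"
      by (simp add: power2_eq_square sum_product mult_ac)
    also have "(\<Sum>i\<in>I. \<Sum>t\<in>T. \<Sum>t'\<in>T. g t * g t' * (A t i * A t' i))
        = (\<Sum>t\<in>T. \<Sum>t'\<in>T. \<Sum>i\<in>I. g t * g t' * (A t i * A t' i))"
      by (subst sum.swap, rule sum.cong[OF refl], subst sum.swap, rule refl)
    also have "\<sigma>\<^sup>2 * \<dots> = (\<Sum>t\<in>T. \<Sum>t'\<in>T. g t * g t' * (\<sigma>\<^sup>2 * (\<Sum>i\<in>I. A t i * A t' i)))"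
      by (simp add: sum_distrib_left mult_ac)
    also have "\<dots> = (\<Sum>t\<in>T. \<Sum>t'\<in>T. g t * g t' * (if t = t' then 1 else 0))"
      using orth by (intro sum.cong refl) simp
    also have "\<dots> = (\<Sum>t\<in>T. (g t)\<^sup>2)"
      using T by (simp add: if_distrib[of "\<lambda>x. _ * x"] power2_eq_square cong: if_cong)
    finally have "\<sigma>\<^sup>2 * (\<Sum>i\<in>I. (\<Sum>t\<in>T. A t i * g t)\<^sup>2) = (\<Sum>t\<in>T. (g t)\<^sup>2)" .
    moreover have "\<sigma>\<^sup>2 / 2 * (\<Sum>i\<in>I. (v * (\<Sum>t\<in>T. A t i * g t))\<^sup>2)
        = u * (\<sigma>\<^sup>2 * (\<Sum>i\<in>I. (\<Sum>t\<in>T. A t i * g t)\<^sup>2))"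
      by (simp add: power_mult_distrib v sum_distrib_left[symmetric])
    ultimately show ?thesis
      unfolding P_def eq PiM_gaussian_exp_linear[OF s I] using T
      by (simp add: exp_sum sum_distrib_left)
  qed
  have "(\<integral>\<^sup>+\<omega>. ennreal (exp (u * (\<Sum>t\<in>T. (\<Sum>i\<in>I. A t i * \<omega> i)\<^sup>2))) \<partial>P)
      = (\<integral>\<^sup>+\<omega>. (\<integral>\<^sup>+g. ennreal (exp (B \<omega> g)) \<partial>Q) \<partial>P)"
    by (simp add: inner)
  also have "\<dots> = (\<integral>\<^sup>+g. (\<integral>\<^sup>+\<omega>. ennreal (exp (B \<omega> g)) \<partial>P) \<partial>Q)"
    by (rule Fubini'[symmetric]) measurable
  also have "\<dots> = (\<integral>\<^sup>+g. ennreal (\<Prod>t\<in>T. exp (u * (g t)\<^sup>2)) \<partial>Q)"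
    by (simp add: outer)
  also have "\<dots> = (\<Prod>t\<in>T. \<integral>\<^sup>+x. ennreal (exp (u * x\<^sup>2)) \<partial>gaussian 1)"
    unfolding Q_def by (rule nn_integral_PiM_gaussian_prod[OF _ T]) auto
  also have "\<dots> = ennreal ((1 / sqrt (1 - 2 * u)) ^ card T)"
    using u by (simp only: gaussian_exp_square prod_constant) (simp add: ennreal_power)
  finally show ?thesis unfolding P_def .
qed

text \<open>The linear form has variance 1. The crude bound 6 comes from the exponential moment
  already available: \<open>x\<^sup>2 \<le> 3 * exp (3 / 8 * x\<^sup>2)\<close>, and the coefficient
  \<open>3 / 8\<close> makes \<open>1 / sqrt (1 - 2 * u)\<close> equal to 2.\<close>

lemma PiM_gaussian_second_moment:
  fixes a :: "'i \<Rightarrow> real"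
  assumes s: "\<sigma> > 0" and I: "finite I" and n: "\<sigma>\<^sup>2 * (\<Sum>i\<in>I. (a i)\<^sup>2) = 1"
  shows "(\<integral>\<^sup>+\<omega>. ennreal ((\<Sum>i\<in>I. a i * \<omega> i)\<^sup>2) \<partial>(\<Pi>\<^sub>M i\<in>I. gaussian \<sigma>)) \<le> 6"
proof -
  define L where "L = (\<lambda>\<omega>. \<Sum>i\<in>I. a i * \<omega> i)"
  have Lm: "L \<in> borel_measurable (\<Pi>\<^sub>M i\<in>I. gaussian \<sigma>)"
    unfolding L_def by measurable
  have "x\<^sup>2 \<le> 3 * exp (3 / 8 * x\<^sup>2)" for x :: real
  proof -
    have "1 + 3 / 8 * x\<^sup>2 \<le> exp (3 / 8 * x\<^sup>2)" by (rule exp_ge_add_one_self)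
    moreover have "0 \<le> x\<^sup>2" by simp
    ultimately show ?thesis by linarith
  qed
  then have "(\<integral>\<^sup>+\<omega>. ennreal ((L \<omega>)\<^sup>2) \<partial>(\<Pi>\<^sub>M i\<in>I. gaussian \<sigma>))
      \<le> (\<integral>\<^sup>+\<omega>. 3 * ennreal (exp (3 / 8 * (L \<omega>)\<^sup>2)) \<partial>(\<Pi>\<^sub>M i\<in>I. gaussian \<sigma>))"
    by (intro nn_integral_mono) (simp add: ennreal_mult[symmetric] flip: ennreal_numeral)
  also have "\<dots> = 3 * (\<integral>\<^sup>+\<omega>. ennreal (exp (3 / 8 * (L \<omega>)\<^sup>2)) \<partial>(\<Pi>\<^sub>M i\<in>I. gaussian \<sigma>))"
    by (rule nn_integral_cmult) (rule measurable_compose[OF Lm], measurable)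
  also have "(\<integral>\<^sup>+\<omega>. ennreal (exp (3 / 8 * (L \<omega>)\<^sup>2)) \<partial>(\<Pi>\<^sub>M i\<in>I. gaussian \<sigma>)) = 2"
  proof -
    have q: "sqrt (1 / 4) = (1 / 2 :: real)" by (rule real_sqrt_unique) (auto simp: power2_eq_square)
    show ?thesis
      using PiM_gaussian_exp_quadratic[OF s I, of "{()}" "3/8" "\<lambda>_. a"] n
      by (simp add: q L_def power2_eq_square)
  qed
  also have "(3 :: ennreal) * 2 = 6"
    by simp
  finally show ?thesis unfolding L_def .
qed

subsection \<open>Discrete Fourier analysis on the lattice\<close>

definition wave :: "nat \<Rightarrow> int \<Rightarrow> nat \<Rightarrow> complex" where
  "wave m k i = cis (2 * pi * real_of_int k * real i / real m)"

lemma exp_eq_wave: "exp (2 * of_real pi * \<i> * of_int k * of_nat i / of_nat m) = wave m k i"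
  unfolding wave_def cis_conv_exp by (rule arg_cong[of _ _ exp]) simp

lemma exp_minus_eq_wave:
  "exp (- (2 * of_real pi * \<i> * of_int k * of_nat i / of_nat m)) = wave m (- k) i"
  unfolding wave_def cis_conv_exp by (rule arg_cong[of _ _ exp]) simp

lemma wave_0 [simp]: "wave m 0 i = 1"
  by (simp add: wave_def)

lemma wave_add: "wave m (k + k') i = wave m k i * wave m k' i"
  by (simp add: wave_def cis_mult algebra_simps add_divide_distrib)

lemma cnj_wave: "cnj (wave m k i) = wave m (- k) i"
  by (simp add: wave_def cis_cnj)

text \<open>A full geometric sum whose ratio is an \<open>m\<close>-th root of unity different from
  1.\<close>

lemma sum_roots_of_unity:
  fixes q :: int
  assumes m: "m > 0" and q: "\<not> int m dvd q"
  shows "(\<Sum>t<m. cis (2 * pi * real_of_int q * real t / real m)) = 0"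
proof -
  define w where "w = cis (2 * pi * real_of_int q / real m)"
  have pw: "cis (2 * pi * real_of_int q * real t / real m) = w ^ t" for t
    by (simp add: w_def Complex.DeMoivre mult_ac)
  have "w \<noteq> 1"
  proof
    assume "w = 1"
    then have "exp (\<i> * complex_of_real (2 * pi * real_of_int q / real m)) = 1"
      by (simp add: w_def cis_conv_exp)
    then obtain r :: int where "2 * pi * real_of_int q / real m = of_int (2 * r) * pi"
      unfolding exp_eq_1 by auto
    then have "real_of_int q = real_of_int (r * int m)"
      using m by (simp add: field_simps)
    then have "q = r * int m" by (simp only: of_int_eq_iff)
    with q show False by simp
  qed
  moreover have "w ^ m = 1"
    using m by (simp add: w_def Complex.DeMoivre)
  ultimately show ?thesis
    by (simp add: pw sum_gp_strict)
qed

lemma not_dvd_small: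
  fixes q :: int
  assumes "q \<noteq> 0" "\<bar>q\<bar> < int m"
  shows "\<not> int m dvd q"
  using assms zdvd_imp_le[of "int m" "\<bar>q\<bar>"] by auto

lemma sum_wave:
  assumes "k \<noteq> 0" "\<bar>k\<bar> < int m"
  shows "(\<Sum>i<m. wave m k i) = 0"
  unfolding wave_def using assms by (intro sum_roots_of_unity not_dvd_small) auto

text \<open>For odd \<open>m\<close> the symmetric range of frequencies is a complete residue system
  modulo \<open>m\<close>. Shifting it to \<open>0, ..., m - 1\<close> turns the kernel into a sum
  of roots of unity.\<close>

lemma fourier_inversion:
  assumes m: "odd m" and i: "i < m"
  shows "(\<Sum>k | \<bar>k\<bar> \<le> (int m - 1) div 2. dft m v k * wave m (- k) i) = of_real (v i)"
proof -
  define K where "K = (m - 1) div 2"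
  have mK: "m = 2 * K + 1" using m by (auto simp: K_def elim: oddE)
  have range: "{k. \<bar>k\<bar> \<le> (int m - 1) div 2} = (\<lambda>t. int t - int K) ` {..<m}"
  proof safe
    fix k :: int assume "\<bar>k\<bar> \<le> (int m - 1) div 2"
    then have "k = int (nat (k + int K)) - int K" "nat (k + int K) \<in> {..<m}"
      using mK by auto
    then show "k \<in> (\<lambda>t. int t - int K) ` {..<m}" by blast
  qed (use mK in auto)
  have kernel: "(\<Sum>k | \<bar>k\<bar> \<le> (int m - 1) div 2. wave m k i' * wave m (- k) i) = (if i' = i then of_nat m else 0)"
    if i': "i' < m" for i'
  proof -
    define q where "q = int i' - int i"
    \<comment> \<open>The shift by \<open>K\<close> only contributes a phase that does not depend on
      \<open>t\<close>, so it leaves the vanishing sum untouched.\<close>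
    have e: "wave m (int t - int K) i' * wave m (int K - int t) i
        = cis (- 2 * pi * real K * real_of_int q / real m)
          * cis (2 * pi * real_of_int q * real t / real m)" for t
      by (simp add: wave_def cis_mult q_def algebra_simps add_divide_distrib diff_divide_distrib)
    have "(\<Sum>k | \<bar>k\<bar> \<le> (int m - 1) div 2. wave m k i' * wave m (- k) i)
        = cis (- 2 * pi * real K * real_of_int q / real m)
          * (\<Sum>t<m. cis (2 * pi * real_of_int q * real t / real m))"
      unfolding range by (subst sum.reindex) (auto simp: inj_on_def e sum_distrib_left)
    moreover have "(\<Sum>t<m. cis (2 * pi * real_of_int q * real t / real m)) = 0" if "i' \<noteq> i"
      using that i i' by (intro sum_roots_of_unity not_dvd_small) (auto simp: q_def)
    moreover have "q = 0" if "i' = i" using that by (simp add: q_def)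
    ultimately show ?thesis by auto
  qed
  have "(\<Sum>k | \<bar>k\<bar> \<le> (int m - 1) div 2. dft m v k * wave m (- k) i)
      = (\<Sum>k | \<bar>k\<bar> \<le> (int m - 1) div 2. \<Sum>i'<m.
          1 / of_nat m * of_real (v i') * (wave m k i' * wave m (- k) i))"
    unfolding dft_def exp_eq_wave by (simp add: sum_distrib_left sum_distrib_right mult_ac)
  also have "\<dots> = (\<Sum>i'<m. 1 / of_nat m * of_real (v i') *
      (\<Sum>k | \<bar>k\<bar> \<le> (int m - 1) div 2. wave m k i' * wave m (- k) i))"
    by (subst sum.swap) (simp add: sum_distrib_left)
  also have "\<dots> = (\<Sum>i'<m. if i' = i then of_real (v i) else 0)"
    using i by (intro sum.cong refl) (auto simp: kernel)
  also have "\<dots> = of_real (v i)"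
    using i by simp
  finally show ?thesis .
qed

section \<open>Orthogonality of the one-coordinate waves on the lattice\<close>

lemma finite_lattice [simp]: "finite (lattice d n)"
  unfolding lattice_def by (rule finite_PiE) auto

lemma card_lattice: "card (lattice d n) = sample_size d n"
  unfolding lattice_def sample_size_def by (simp add: card_PiE)

definition chi :: "(nat \<Rightarrow> nat) \<Rightarrow> nat \<times> int \<Rightarrow> (nat \<Rightarrow> nat) \<Rightarrow> complex" where
  "chi n b l = wave (n (fst b)) (snd b) (l (fst b))"

text \<open>Frequency 0 is left out because it gives the same constant function for every
  coordinate, which would destroy orthogonality.\<close>

definition freqs :: "nat \<Rightarrow> (nat \<Rightarrow> nat) \<Rightarrow> (nat \<times> int) set" where
  "freqs d n = (SIGMA j:{1..d}. {k. 1 \<le> \<bar>k\<bar> \<and> \<bar>k\<bar> \<le> (int (n j) - 1) div 2})"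

text \<open>The constant function is the wave with index \<open>(0, 0)\<close>.\<close>

definition freqs0 :: "nat \<Rightarrow> (nat \<Rightarrow> nat) \<Rightarrow> (nat \<times> int) set" where
  "freqs0 d n = insert (0, 0) (freqs d n)"

lemma chi_00 [simp]: "chi n (0, 0) l = 1"
  by (simp add: chi_def)

lemma finite_abs_le [simp]: "finite {k :: int. \<bar>k\<bar> \<le> a}"
  by (rule finite_subset[of _ "{- a..a}"]) auto

lemma finite_band [simp]: "finite {k :: int. 1 \<le> \<bar>k\<bar> \<and> \<bar>k\<bar> \<le> a}"
  by (rule finite_subset[of _ "{k. \<bar>k\<bar> \<le> a}"]) auto

lemma finite_freqs [simp]: "finite (freqs d n)"
  unfolding freqs_def by (rule finite_SigmaI) auto

lemma finite_freqs0 [simp]: "finite (freqs0 d n)"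
  by (simp add: freqs0_def)

lemma zero_notin_freqs [simp]: "(0, 0) \<notin> freqs d n"
  by (simp add: freqs_def)

lemma freqs_subset_freqs0: "freqs d n \<subseteq> freqs0 d n"
  by (auto simp: freqs0_def)

text \<open>The lattice is the product of coordinate \<open>j\<close> and the remaining ones, and
  \<open>G\<close> is constant along coordinate \<open>j\<close>; so the sum of \<open>F\<close>
  splits off as a factor.\<close>

lemma sum_lattice_coord:
  fixes F :: "nat \<Rightarrow> complex"
  assumes j: "j \<in> {1..d}" and z: "(\<Sum>i<n j. F i) = 0"
    and G: "\<And>l i. l \<in> lattice d n \<Longrightarrow> i < n j \<Longrightarrow> G (l(j := i)) = G l"
  shows "(\<Sum>l\<in>lattice d n. F (l j) * G l) = 0"
proof -
  have eq: "lattice d n = (\<lambda>(i, l). l(j := i)) ` ({..<n j} \<times> (\<Pi>\<^sub>E j'\<in>{1..d} - {j}. {..<n j'}))"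
  proof -
    have "insert j ({1..d} - {j}) = {1..d}" using j by auto
    then show ?thesis
      unfolding lattice_def using PiE_insert_eq[of j "{1..d} - {j}" "\<lambda>j. {..<n j}"] by simp
  qed
  have inj: "inj_on (\<lambda>(i, l). l(j := i)) ({..<n j} \<times> (\<Pi>\<^sub>E j'\<in>{1..d} - {j}. {..<n j'}))"
    by (rule inj_combinator) simp
  show ?thesis
  proof (cases "n j = 0")
    case True
    then have "lattice d n = {}" using j by (auto simp: lattice_def PiE_eq_empty_iff)
    then show ?thesis by simp
  next
    case False
    have Geq: "G (l(j := i)) = G (l(j := 0))"
      if "l \<in> (\<Pi>\<^sub>E j'\<in>{1..d} - {j}. {..<n j'})" "i < n j" for l i
    proof -
      have "l(j := 0) \<in> lattice d n" using that False by (subst eq) force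
      from G[OF this that(2)] show ?thesis by simp
    qed
    have "(\<Sum>l\<in>lattice d n. F (l j) * G l)
        = (\<Sum>(i, l)\<in>{..<n j} \<times> (\<Pi>\<^sub>E j'\<in>{1..d} - {j}. {..<n j'}). F i * G (l(j := i)))"
      by (subst eq, subst sum.reindex[OF inj]) (simp add: case_prod_beta')
    also have "\<dots> = (\<Sum>(i, l)\<in>{..<n j} \<times> (\<Pi>\<^sub>E j'\<in>{1..d} - {j}. {..<n j'}). F i * G (l(j := 0)))"
    proof (rule sum.cong[OF refl])
      fix x assume x: "x \<in> {..<n j} \<times> (\<Pi>\<^sub>E j'\<in>{1..d} - {j}. {..<n j'})"
      have "G ((snd x)(j := fst x)) = G ((snd x)(j := 0))"
        by (rule Geq) (use x in \<open>auto simp only: mem_Times_iff lessThan_iff\<close>)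
      then show "(case x of (i, l) \<Rightarrow> F i * G (l(j := i))) = (case x of (i, l) \<Rightarrow> F i * G (l(j := 0)))"
        by (simp add: case_prod_beta')
    qed
    also have "\<dots> = (\<Sum>i<n j. F i) * (\<Sum>l\<in>(\<Pi>\<^sub>E j'\<in>{1..d} - {j}. {..<n j'}). G (l(j := 0)))"
      by (simp add: sum.cartesian_product[symmetric] sum_product)
    finally show ?thesis by (simp add: z)
  qed
qed

lemma sum_chi:
  assumes "b \<in> freqs d n" shows "(\<Sum>l\<in>lattice d n. chi n b l) = 0"
proof -
  obtain j k where b: "b = (j, k)" "j \<in> {1..d}" "1 \<le> \<bar>k\<bar>" "\<bar>k\<bar> \<le> (int (n j) - 1) div 2"
    using assms by (auto simp: freqs_def)
  then have "(\<Sum>i<n j. wave (n j) k i) = 0" by (intro sum_wave) auto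
  from sum_lattice_coord[where n = n and j = j and F = "wave (n j) k" and G = "\<lambda>_. 1", OF b(2) this] show ?thesis
    by (simp add: chi_def b(1))
qed

text \<open>On the same coordinate the product is again a wave, of frequency \<open>k - k'\<close>,
  nonzero and smaller than \<open>n j\<close> in absolute value. On different coordinates one factor
  is constant along the coordinate of the other, which sums to zero.\<close>

lemma chi_orthogonal:
  assumes b: "b \<in> freqs0 d n" and b': "b' \<in> freqs0 d n"
  shows "(\<Sum>l\<in>lattice d n. chi n b l * cnj (chi n b' l))
      = (if b = b' then of_nat (sample_size d n) else 0)"
proof (cases "b = b'")
  case True
  have "chi n b l * cnj (chi n b l) = 1" for l
    by (simp add: chi_def cnj_wave wave_add[symmetric])
  then show ?thesis using True by (simp add: card_lattice)
next
  case False
  consider (l) "b = (0, 0)" "b' \<in> freqs d n" | (r) "b \<in> freqs d n" "b' = (0, 0)"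
    | (same) k k' j where "b = (j, k)" "b' = (j, k')" "b \<in> freqs d n" "b' \<in> freqs d n"
    | (diff) k k' j j' where "b = (j, k)" "b' = (j', k')" "j \<noteq> j'" "b \<in> freqs d n" "b' \<in> freqs d n"
    using b b' False unfolding freqs0_def
    by (metis insert_iff prod.collapse)
  then have "(\<Sum>l\<in>lattice d n. chi n b l * cnj (chi n b' l)) = 0"
  proof cases
    case l
    then show ?thesis using sum_chi[OF l(2)] by (simp flip: cnj_sum)
  next
    case r
    then show ?thesis using sum_chi[OF r(1)] by simp
  next
    case same
    then have j: "j \<in> {1..d}" and "k \<noteq> k'" "\<bar>k\<bar> \<le> (int (n j) - 1) div 2" "\<bar>k'\<bar> \<le> (int (n j) - 1) div 2"
        "1 \<le> \<bar>k\<bar>"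
      using False by (auto simp: freqs_def)
    then have "(\<Sum>i<n j. wave (n j) (k - k') i) = 0" by (intro sum_wave) auto
    from sum_lattice_coord[where n = n and j = j and F = "wave (n j) (k - k')" and G = "\<lambda>_. 1", OF j this] show ?thesis
      by (simp add: chi_def same(1,2) cnj_wave wave_add[symmetric])
  next
    case diff
    then have j: "j \<in> {1..d}" and k: "\<bar>k\<bar> \<le> (int (n j) - 1) div 2" "1 \<le> \<bar>k\<bar>"
      by (auto simp: freqs_def)
    then have "(\<Sum>i<n j. wave (n j) k i) = 0" by (intro sum_wave) auto
    from sum_lattice_coord[where n = n and j = j and F = "wave (n j) k" and G = "\<lambda>l. cnj (chi n b' l)", OF j this] diff show ?thesis
      by (simp add: chi_def)
  qed
  with False show ?thesis by simp
qed

lemma parseval_lattice: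
  assumes N: "sample_size d n > 0"
  shows "1 / real (sample_size d n) *
      (\<Sum>l\<in>lattice d n. (cmod (\<Sum>b\<in>freqs0 d n. x b * cnj (chi n b l)))\<^sup>2)
    = (\<Sum>b\<in>freqs0 d n. (cmod (x b))\<^sup>2)"
proof -
  let ?B = "freqs0 d n"
  have "complex_of_real (\<Sum>l\<in>lattice d n. (cmod (\<Sum>b\<in>?B. x b * cnj (chi n b l)))\<^sup>2)
      = (\<Sum>l\<in>lattice d n. \<Sum>b\<in>?B. \<Sum>b'\<in>?B. x b * cnj (x b') * (chi n b' l * cnj (chi n b l)))"
    unfolding of_real_sum complex_norm_square
    by (intro sum.cong refl) (simp add: sum_product mult_ac)
  also have "\<dots> = (\<Sum>b\<in>?B. \<Sum>b'\<in>?B. \<Sum>l\<in>lattice d n. x b * cnj (x b') * (chi n b' l * cnj (chi n b l)))"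
    by (subst sum.swap, rule sum.cong[OF refl], subst sum.swap, rule refl)
  also have "\<dots> = (\<Sum>b\<in>?B. \<Sum>b'\<in>?B. x b * cnj (x b') * (if b' = b then of_nat (sample_size d n) else 0))"
    by (simp add: sum_distrib_left[symmetric] chi_orthogonal cong: sum.cong)
  also have "\<dots> = (\<Sum>b\<in>?B. x b * cnj (x b) * of_nat (sample_size d n))"
    by (simp add: if_distrib[of "\<lambda>y. _ * y"] cong: if_cong)
  also have "\<dots> = complex_of_real (real (sample_size d n) * (\<Sum>b\<in>?B. (cmod (x b))\<^sup>2))"
    unfolding of_real_mult of_real_sum complex_norm_square by (simp add: sum_distrib_left mult_ac)
  finally have "(\<Sum>l\<in>lattice d n. (cmod (\<Sum>b\<in>?B. x b * cnj (chi n b l)))\<^sup>2)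
      = real (sample_size d n) * (\<Sum>b\<in>?B. (cmod (x b))\<^sup>2)"
    by (simp only: of_real_eq_iff)
  with N show ?thesis by simp
qed

text \<open>The Hartley functions \<open>cos + sin\<close> turn the complex system into a real orthogonal one with the
  same index set, which makes the noise coefficients independent real Gaussians.\<close>

definition cas :: "(nat \<Rightarrow> nat) \<Rightarrow> nat \<times> int \<Rightarrow> (nat \<Rightarrow> nat) \<Rightarrow> real" where
  "cas n b l = Re (chi n b l) + Im (chi n b l)"

text \<open>A product of two Hartley functions is the real part of \<open>chi * cnj chi'\<close>
  plus the imaginary part of \<open>chi * chi'\<close>. The index set is symmetric under
  \<open>k \<rightarrow> - k\<close>, so the second sum is again a Hermitian inner product of two
  waves; it equals 0 or the sample size, hence is real and drops out.\<close>

lemma cas_orthogonal: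
  assumes b: "b \<in> freqs0 d n" and b': "b' \<in> freqs0 d n"
  shows "(\<Sum>l\<in>lattice d n. cas n b l * cas n b' l) = (if b = b' then real (sample_size d n) else 0)"
proof -
  define b'' where "b'' = (fst b', - snd b')"
  have "b'' \<in> freqs0 d n" using b' by (auto simp: b''_def freqs0_def freqs_def)
  moreover have "chi n b' l = cnj (chi n b'' l)" for l
    by (simp add: chi_def b''_def cnj_wave)
  ultimately have im: "Im (\<Sum>l\<in>lattice d n. chi n b l * chi n b' l) = 0"
    by (simp add: chi_orthogonal[OF b])
  have "(\<Sum>l\<in>lattice d n. cas n b l * cas n b' l)
      = (\<Sum>l\<in>lattice d n. Re (chi n b l * cnj (chi n b' l)) + Im (chi n b l * chi n b' l))"
    by (intro sum.cong refl) (simp add: cas_def algebra_simps)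
  also have "\<dots> = Re (\<Sum>l\<in>lattice d n. chi n b l * cnj (chi n b' l))
      + Im (\<Sum>l\<in>lattice d n. chi n b l * chi n b' l)"
    by (simp only: sum.distrib Re_sum Im_sum)
  also have "\<dots> = (if b = b' then real (sample_size d n) else 0)"
    unfolding im by (simp add: chi_orthogonal[OF b b'])
  finally show ?thesis .
qed

section \<open>Models as symmetric frequency sets, and empirical coefficients\<close>

definition model :: "nat set \<Rightarrow> (nat \<Rightarrow> nat) \<Rightarrow> (nat \<times> int) set" where
  "model J \<kappa> = (SIGMA j:J. {k. 1 \<le> \<bar>k\<bar> \<and> \<bar>k\<bar> \<le> int (\<kappa> j)})"

lemma sum_model:
  "finite J \<Longrightarrow> (\<Sum>b\<in>model J \<kappa>. F b) = (\<Sum>j\<in>J. \<Sum>k | 1 \<le> \<bar>k\<bar> \<and> \<bar>k\<bar> \<le> int (\<kappa> j). F (j, k))"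
  unfolding model_def by (subst sum.Sigma) (auto simp: case_prod_beta')

lemma card_band: "card {k :: int. 1 \<le> \<bar>k\<bar> \<and> \<bar>k\<bar> \<le> int m} = 2 * m"
proof -
  have "{k :: int. 1 \<le> \<bar>k\<bar> \<and> \<bar>k\<bar> \<le> int m} = {1..int m} \<union> {- int m..-1}" by auto
  then show ?thesis by (simp add: card_Un_disjoint)
qed

text \<open>Each unit of cut-point brings the two frequencies \<open>k\<close> and
  \<open>- k\<close>. This removes the square root in \<open>1 / sqrt (1 - 2 * u)\<close> when
  moments are counted per unit of cut-point.\<close>

lemma card_model: "finite J \<Longrightarrow> card (model J \<kappa>) = 2 * (\<Sum>j\<in>J. \<kappa> j)"
  unfolding model_def by (subst card_SigmaI) (auto simp: card_band sum_distrib_left)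

lemma finite_model: "finite J \<Longrightarrow> finite (model J \<kappa>)"
  unfolding model_def by (rule finite_SigmaI) auto

lemma model_subset_freqs:
  assumes "admissible d n J \<kappa>" shows "model J \<kappa> \<subseteq> freqs d n"
proof
  fix b assume "b \<in> model J \<kappa>"
  then obtain j k where b: "b = (j, k)" "j \<in> J" "1 \<le> \<bar>k\<bar>" "\<bar>k\<bar> \<le> int (\<kappa> j)"
    by (auto simp: model_def)
  with assms have "j \<in> {1..d}" "1 \<le> \<kappa> j" "\<kappa> j \<le> (n j - 1) div 2" by (auto simp: admissible_def)
  with b show "b \<in> freqs d n" by (auto simp: freqs_def)
qed

lemma admissible_finite: "admissible d n J \<kappa> \<Longrightarrow> finite J"
  by (auto simp: admissible_def intro: finite_subset)

text \<open>The inner product is taken against \<open>chi\<close>, while functions are expanded in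
  \<open>cnj (chi n b l)\<close>, matching the sign convention of \<open>dft\<close>. At index
  \<open>(0, 0)\<close> it is the sample mean, so \<open>a0hat\<close> and all \<open>xi\<close>
  share one formula.\<close>

definition coef :: "nat \<Rightarrow> (nat \<Rightarrow> nat) \<Rightarrow> ((nat \<Rightarrow> nat) \<Rightarrow> real) \<Rightarrow> nat \<times> int \<Rightarrow> complex" where
  "coef d n y b = (\<Sum>l\<in>lattice d n. of_real (y l) * chi n b l) / of_nat (sample_size d n)"

text \<open>Real data give conjugate coefficients at \<open>k\<close> and \<open>- k\<close>, so the
  Hartley coefficients there are \<open>Re + Im\<close> and \<open>Re - Im\<close> of the same
  number, and their squares add up to twice the squared modulus. The identity holds only after
  summing over a symmetric set, not term by term.\<close>

lemma sum_coef_model_eq_cas: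
  assumes J: "finite J"
  shows "(\<Sum>b\<in>model J \<kappa>. (cmod (coef d n y b))\<^sup>2)
    = (\<Sum>b\<in>model J \<kappa>. ((\<Sum>l\<in>lattice d n. cas n b l * y l) / real (sample_size d n))\<^sup>2)"
proof -
  define H where "H = (\<lambda>b. (\<Sum>l\<in>lattice d n. cas n b l * y l) / real (sample_size d n))"
  define neg :: "nat \<times> int \<Rightarrow> nat \<times> int" where "neg = (\<lambda>b. (fst b, - snd b))"
  have H: "H b = Re (coef d n y b) + Im (coef d n y b)" for b
    by (simp add: H_def coef_def cas_def algebra_simps sum.distrib
        add_divide_distrib)
  have c: "coef d n y (neg b) = cnj (coef d n y b)" for b
    by (simp add: coef_def neg_def chi_def cnj_wave)
  have "2 * (cmod (coef d n y b))\<^sup>2 = (H b)\<^sup>2 + (H (neg b))\<^sup>2" for b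
    by (simp add: H c cmod_power2 power2_sum power2_diff)
  then have "2 * (\<Sum>b\<in>model J \<kappa>. (cmod (coef d n y b))\<^sup>2)
      = (\<Sum>b\<in>model J \<kappa>. (H b)\<^sup>2) + (\<Sum>b\<in>model J \<kappa>. (H (neg b))\<^sup>2)"
    by (simp add: sum_distrib_left sum.distrib)
  also have "(\<Sum>b\<in>model J \<kappa>. (H (neg b))\<^sup>2) = (\<Sum>b\<in>model J \<kappa>. (H b)\<^sup>2)"
    by (rule sum.reindex_bij_witness[of _ neg neg]) (auto simp: neg_def model_def)
  finally show ?thesis by (simp add: H_def)
qed

text \<open>Averaging over the other coordinates and then transforming is one sum over the lattice,
  grouped by the value of coordinate \<open>j\<close>; the two normalizations multiply to one over
  the sample size.\<close>

lemma xi_eq_coef: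
  assumes j: "j \<in> {1..d}" and n: "n j > 0"
  shows "xi d n y j k = coef d n y (j, k)"
proof -
  define A where "A = (\<lambda>i. \<Sum>l | l \<in> lattice d n \<and> l j = i. y l)"
  have "xi d n y j k = (\<Sum>i<n j. complex_of_real (A i) * wave (n j) k i) / of_nat (sample_size d n)"
  proof -
    have "marginal_mean d n y j = (\<lambda>i. A i / (real (sample_size d n) / real (n j)))"
      by (simp add: marginal_mean_def A_def fun_eq_iff)
    then show ?thesis
      using n unfolding xi_def dft_def exp_eq_wave
      by (simp add: sum_distrib_left sum_divide_distrib field_simps)
  qed
  also have "(\<Sum>i<n j. complex_of_real (A i) * wave (n j) k i)
      = (\<Sum>i<n j. \<Sum>l | l \<in> lattice d n \<and> l j = i. of_real (y l) * wave (n j) k (l j))"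
    by (simp add: A_def sum_distrib_right)
  also have "\<dots> = (\<Sum>l\<in>lattice d n. of_real (y l) * wave (n j) k (l j))"
    by (rule sum.group) (use j in \<open>auto simp: lattice_def intro!: finite_PiE\<close>)
  finally show ?thesis by (simp add: coef_def chi_def)
qed

subsection \<open>The sequence model\<close>

lemma sample_size_pos: "(\<And>j. j \<in> {1..d} \<Longrightarrow> n j > 0) \<Longrightarrow> sample_size d n > 0"
  unfolding sample_size_def by (rule prod_pos) blast

lemma sum_freqs:
  "(\<Sum>b\<in>freqs d n. F b)
    = (\<Sum>j=1..d. \<Sum>k | 1 \<le> \<bar>k\<bar> \<and> \<bar>k\<bar> \<le> (int (n j) - 1) div 2. F (j, k))"
  unfolding freqs_def by (subst sum.Sigma) (auto simp: case_prod_beta')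

lemma sum_freqs0: "(\<Sum>b\<in>freqs0 d n. F b) = F (0, 0) + (\<Sum>b\<in>freqs d n. F b)"
  by (simp add: freqs0_def)

lemma sum_band_0:
  "F 0 = 0 \<Longrightarrow> (\<Sum>k | \<bar>k\<bar> \<le> K. F k) = (\<Sum>k :: int | 1 \<le> \<bar>k\<bar> \<and> \<bar>k\<bar> \<le> K. F k)"
proof (rule sum.mono_neutral_right[OF finite_abs_le])
  assume z: "F 0 = 0"
  show "\<forall>i\<in>{k. \<bar>k\<bar> \<le> K} - {k. 1 \<le> \<bar>k\<bar> \<and> \<bar>k\<bar> \<le> K}. F i = 0"
  proof
    fix i assume "i \<in> {k. \<bar>k\<bar> \<le> K} - {k. 1 \<le> \<bar>k\<bar> \<and> \<bar>k\<bar> \<le> K}"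
    then have "i = 0" by auto
    with z show "F i = 0" by simp
  qed
qed blast

definition theta ::
  "(nat \<Rightarrow> nat) \<Rightarrow> real \<Rightarrow> (nat \<Rightarrow> real \<Rightarrow> real) \<Rightarrow> nat \<times> int \<Rightarrow> complex" where
  "theta n a0 f b = (if b = (0, 0) then of_real a0
     else fourier_coeff (n (fst b)) (f (fst b)) (snd b))"

text \<open>Centred components contain no zero frequency, so \<open>a0\<close> is the only constant
  term and the expansion runs over \<open>freqs0\<close> without repetition.\<close>

lemma additive_fun_expansion:
  assumes odd: "\<And>j. j \<in> {1..d} \<Longrightarrow> odd (n j)"
    and c0: "\<And>j. j \<in> {1..d} \<Longrightarrow> fourier_coeff (n j) (f j) 0 = 0"
    and l: "l \<in> lattice d n"
  shows "of_real (additive_fun d a0 f (grid_point n l))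
    = (\<Sum>b\<in>freqs0 d n. theta n a0 f b * cnj (chi n b l))"
proof -
  have "complex_of_real (f j (grid_point n l j))
      = (\<Sum>k | 1 \<le> \<bar>k\<bar> \<and> \<bar>k\<bar> \<le> (int (n j) - 1) div 2. theta n a0 f (j, k) * cnj (chi n (j, k) l))"
    if j: "j \<in> {1..d}" for j
  proof -
    have "l j < n j" using j l by (auto simp: lattice_def PiE_def Pi_def)
    from fourier_inversion[OF odd[OF j] this, of "\<lambda>i. f j (real i / real (n j))"]
    have "complex_of_real (f j (grid_point n l j))
      = (\<Sum>k | \<bar>k\<bar> \<le> (int (n j) - 1) div 2. fourier_coeff (n j) (f j) k * wave (n j) (- k) (l j))"
      by (simp add: fourier_coeff_def grid_point_def)
    also have "\<dots> = (\<Sum>k | 1 \<le> \<bar>k\<bar> \<and> \<bar>k\<bar> \<le> (int (n j) - 1) div 2.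
        fourier_coeff (n j) (f j) k * wave (n j) (- k) (l j))"
      by (rule sum_band_0) (simp add: c0[OF j])
    finally show ?thesis using j by (simp add: theta_def chi_def cnj_wave)
  qed
  then show ?thesis
    by (simp add: additive_fun_def sum_freqs0 sum_freqs) (simp add: theta_def)
qed

text \<open>Orthogonality of the waves separates the components, which yields the sequence model:
  true coefficient plus noise coefficient.\<close>

lemma coef_observations:
  assumes odd: "\<And>j. j \<in> {1..d} \<Longrightarrow> odd (n j)"
    and c0: "\<And>j. j \<in> {1..d} \<Longrightarrow> fourier_coeff (n j) (f j) 0 = 0"
    and b: "b \<in> freqs0 d n"
  shows "coef d n (observations d n a0 f \<epsilon>) b = theta n a0 f b + coef d n \<epsilon> b"
proof -
  have N: "sample_size d n > 0" by (rule sample_size_pos) (use odd odd_pos in blast)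
  have "(\<Sum>l\<in>lattice d n. of_real (additive_fun d a0 f (grid_point n l)) * chi n b l)
      = (\<Sum>l\<in>lattice d n. \<Sum>b'\<in>freqs0 d n. theta n a0 f b' * (chi n b l * cnj (chi n b' l)))"
  proof (rule sum.cong[OF refl])
    fix l assume "l \<in> lattice d n"
    from additive_fun_expansion[OF odd c0 this, of a0]
    show "of_real (additive_fun d a0 f (grid_point n l)) * chi n b l
        = (\<Sum>b'\<in>freqs0 d n. theta n a0 f b' * (chi n b l * cnj (chi n b' l)))"
      by (simp add: sum_distrib_left mult_ac)
  qed
  also have "\<dots> = (\<Sum>b'\<in>freqs0 d n. theta n a0 f b' * (if b = b' then of_nat (sample_size d n) else 0))"
    by (subst sum.swap) (simp add: sum_distrib_left[symmetric] chi_orthogonal[OF b] cong: sum.cong)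
  also have "\<dots> = theta n a0 f b * of_nat (sample_size d n)"
    using b by (simp add: if_distrib[of "\<lambda>y. _ * y"] cong: if_cong)
  finally have *: "(\<Sum>l\<in>lattice d n. of_real (additive_fun d a0 f (grid_point n l)) * chi n b l)
      = theta n a0 f b * of_nat (sample_size d n)" .
  have "(\<Sum>l\<in>lattice d n. of_real (observations d n a0 f \<epsilon> l) * chi n b l)
      = theta n a0 f b * of_nat (sample_size d n) + (\<Sum>l\<in>lattice d n. of_real (\<epsilon> l) * chi n b l)"
    unfolding *[symmetric] sum.distrib[symmetric]
    by (intro sum.cong refl) (simp add: observations_def algebra_simps)
  then show ?thesis using N by (simp add: coef_def add_divide_distrib)
qed

definition model_coef ::
  "nat \<Rightarrow> (nat \<Rightarrow> nat) \<Rightarrow> nat set \<Rightarrow> (nat \<Rightarrow> nat) \<Rightarrow> ((nat \<Rightarrow> nat) \<Rightarrow> real) \<Rightarrow> nat \<times> int \<Rightarrow> complex" where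
  "model_coef d n J \<kappa> y b = (if b \<in> model J \<kappa> then coef d n y b else 0)"

text \<open>Parseval applied to the coefficient errors. The error of the constant is pure noise
  whatever model is selected, since centred components do not affect the overall mean.\<close>

lemma loss_eq:
  fixes d n Jhat khat a0 f \<epsilon>
  defines "y \<equiv> observations d n a0 f \<epsilon>"
  assumes odd: "\<And>j. j \<in> {1..d} \<Longrightarrow> odd (n j)"
    and c0: "\<And>j. j \<in> {1..d} \<Longrightarrow> fourier_coeff (n j) (f j) 0 = 0"
  shows "1 / real (sample_size d n) *
        (\<Sum>l\<in>lattice d n. (cmod (fhat d n Jhat khat y l
          - of_real (additive_fun d a0 f (grid_point n l))))\<^sup>2)
    = (cmod (coef d n \<epsilon> (0, 0)))\<^sup>2
      + (\<Sum>b\<in>freqs d n. (cmod (model_coef d n (Jhat y) (khat y) y b - theta n a0 f b))\<^sup>2)"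
proof -
  define x where "x = (\<lambda>b. if b = (0, 0) then coef d n \<epsilon> (0, 0)
    else model_coef d n (Jhat y) (khat y) y b - theta n a0 f b)"
  have N: "sample_size d n > 0" by (rule sample_size_pos) (use odd odd_pos in blast)
  have a0: "of_real (a0hat d n y) = of_real a0 + coef d n \<epsilon> (0, 0)"
  proof -
    have "(0, 0) \<in> freqs0 d n" by (simp add: freqs0_def)
    from coef_observations[OF odd c0 this, of a0 \<epsilon>] show ?thesis
      by (simp add: a0hat_def coef_def y_def theta_def)
  qed
  have "fhat d n Jhat khat y l - of_real (additive_fun d a0 f (grid_point n l))
      = (\<Sum>b\<in>freqs0 d n. x b * cnj (chi n b l))" if l: "l \<in> lattice d n" for l
  proof -
    have "fhat_component d n Jhat khat y j (l j)
        = (\<Sum>k | 1 \<le> \<bar>k\<bar> \<and> \<bar>k\<bar> \<le> (int (n j) - 1) div 2.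
            model_coef d n (Jhat y) (khat y) y (j, k) * cnj (chi n (j, k) l))"
      if j: "j \<in> {1..d}" for j
    proof -
      have "n j > 0" using odd[OF j] by (auto elim: oddE)
      note xi = xi_eq_coef[where n = n and j = j, OF j this]
      have "fhat_component d n Jhat khat y j (l j)
        = (\<Sum>k | 1 \<le> \<bar>k\<bar> \<and> \<bar>k\<bar> \<le> (int (n j) - 1) div 2. chat d n Jhat khat y j k * wave (n j) (- k) (l j))"
        unfolding fhat_component_def exp_minus_eq_wave by (rule sum_band_0) (simp add: chat_def)
      also have "\<dots> = (\<Sum>k | 1 \<le> \<bar>k\<bar> \<and> \<bar>k\<bar> \<le> (int (n j) - 1) div 2.
            model_coef d n (Jhat y) (khat y) y (j, k) * cnj (chi n (j, k) l))"
        by (intro sum.cong refl) (simp add: chat_def xi model_coef_def model_def chi_def cnj_wave)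
      finally show ?thesis .
    qed
    then have "fhat d n Jhat khat y l = of_real a0 + coef d n \<epsilon> (0, 0)
        + (\<Sum>b\<in>freqs d n. model_coef d n (Jhat y) (khat y) y b * cnj (chi n b l))"
      by (simp add: fhat_def a0 sum_freqs)
    moreover have "(\<Sum>b\<in>freqs d n. x b * cnj (chi n b l))
        = (\<Sum>b\<in>freqs d n. model_coef d n (Jhat y) (khat y) y b * cnj (chi n b l))
          - (\<Sum>b\<in>freqs d n. theta n a0 f b * cnj (chi n b l))"
      unfolding sum_subtractf[symmetric]
      by (intro sum.cong refl) (auto simp: x_def algebra_simps)
    moreover have "x (0, 0) = coef d n \<epsilon> (0, 0)" "theta n a0 f (0, 0) = of_real a0"
      by (simp_all add: x_def theta_def)
    moreover note additive_fun_expansion[OF odd c0 l, of a0]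
    ultimately show ?thesis
      by (simp add: sum_freqs0)
  qed
  then have "1 / real (sample_size d n) *
        (\<Sum>l\<in>lattice d n. (cmod (fhat d n Jhat khat y l
          - of_real (additive_fun d a0 f (grid_point n l))))\<^sup>2)
      = (\<Sum>b\<in>freqs0 d n. (cmod (x b))\<^sup>2)"
    unfolding parseval_lattice[OF N, symmetric] by (simp cong: sum.cong)
  also have "\<dots> = (cmod (coef d n \<epsilon> (0, 0)))\<^sup>2
      + (\<Sum>b\<in>freqs d n. (cmod (model_coef d n (Jhat y) (khat y) y b - theta n a0 f b))\<^sup>2)"
    unfolding sum_freqs0 by (auto simp: x_def intro!: sum.cong)
  finally show ?thesis .
qed

definition model_pen ::
  "nat \<Rightarrow> (nat \<Rightarrow> nat) \<Rightarrow> real \<Rightarrow> real \<Rightarrow> nat pmf \<Rightarrow> (nat \<Rightarrow> nat pmf) \<Rightarrow> nat set \<Rightarrow> (nat \<Rightarrow> nat) \<Rightarrow> real" where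
  "model_pen d n \<sigma> \<gamma> \<pi>0 \<pi> J \<kappa>
    = (\<Sum>j\<in>J. Penj d n \<sigma> \<gamma> (\<pi> j) (\<kappa> j)) + Pen0 d n \<sigma> \<gamma> \<pi>0 (card J)"

lemma MAP_criterion_eq:
  assumes "J \<subseteq> {1..d}" "\<And>j. j \<in> {1..d} \<Longrightarrow> n j > 0"
  shows "MAP_criterion d n \<sigma> \<gamma> \<pi>0 \<pi> y J \<kappa>
    = model_pen d n \<sigma> \<gamma> \<pi>0 \<pi> J \<kappa> - (\<Sum>b\<in>model J \<kappa>. (cmod (coef d n y b))\<^sup>2)"
proof -
  have "finite J" using assms(1) by (rule finite_subset) simp
  moreover have "(\<Sum>j\<in>J. \<Sum>k | 1 \<le> \<bar>k\<bar> \<and> \<bar>k\<bar> \<le> int (\<kappa> j). (cmod (xi d n y j k))\<^sup>2)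
      = (\<Sum>j\<in>J. \<Sum>k | 1 \<le> \<bar>k\<bar> \<and> \<bar>k\<bar> \<le> int (\<kappa> j). (cmod (coef d n y (j, k)))\<^sup>2)"
    using assms by (intro sum.cong refl) (auto simp: xi_eq_coef subset_iff)
  ultimately show ?thesis
    by (simp add: MAP_criterion_def model_pen_def sum_model sum_subtractf)
qed

section \<open>Deterministic comparison of penalized projections\<close>

lemma norm_add_sq_le:
  fixes c z :: "'a :: real_normed_vector"
  assumes "\<beta> > 0"
  shows "(norm (c + z))\<^sup>2 \<le> (1 + 1 / \<beta>) * (norm c)\<^sup>2 + (1 + \<beta>) * (norm z)\<^sup>2"
proof -
  \<comment> \<open>Young's inequality: the cross term is absorbed by expanding this square.\<close>
  have "0 \<le> (norm c - \<beta> * norm z)\<^sup>2 / \<beta>" using assms by simp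
  also have "\<dots> = (norm c)\<^sup>2 / \<beta> - 2 * norm c * norm z + \<beta> * (norm z)\<^sup>2"
    using assms by (simp add: field_simps power2_eq_square)
  finally have "(norm c + norm z)\<^sup>2 \<le> (1 + 1 / \<beta>) * (norm c)\<^sup>2 + (1 + \<beta>) * (norm z)\<^sup>2"
    by (simp add: field_simps power2_eq_square)
  moreover have "(norm (c + z))\<^sup>2 \<le> (norm c + norm z)\<^sup>2"
    by (intro power_mono norm_triangle_ineq) simp
  ultimately show ?thesis by linarith
qed

text \<open>No cross term has to be controlled: the inequality already holds in each coordinate, according to
  its membership in \<open>M\<close> and \<open>M0\<close>.\<close>

lemma projection_oracle:
  fixes c z x :: "'b \<Rightarrow> complex"
  assumes \<gamma>: "\<gamma> > 0" and B: "finite B" and M: "M \<subseteq> B" and M0: "M0 \<subseteq> B"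
    and x: "\<And>b. b \<in> B \<Longrightarrow> x b = c b + z b"
    and opt: "p - (\<Sum>b\<in>M. (cmod (x b))\<^sup>2) \<le> p0 - (\<Sum>b\<in>M0. (cmod (x b))\<^sup>2)"
  shows "min (1 / 2) (1 / (4 * \<gamma>)) * (\<Sum>b\<in>B. (cmod ((if b \<in> M then x b else 0) - c b))\<^sup>2)
    \<le> (1 + 4 * \<gamma>) * (\<Sum>b\<in>B - M0. (cmod (c b))\<^sup>2)
      + (1 + 1 / (2 * \<gamma>)) * (\<Sum>b\<in>M0. (cmod (z b))\<^sup>2) + p0
      + ((1 + 1 / (2 * \<gamma>)) * (\<Sum>b\<in>M. (cmod (z b))\<^sup>2) - p)"
proof -
  define \<delta> where "\<delta> = min (1 / 2) (1 / (4 * \<gamma>))"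
  define q where "q = 1 + 1 / (2 * \<gamma>)"
  have \<delta>: "0 < \<delta>" "\<delta> \<le> 1 / 2" "\<delta> \<le> 1 / (4 * \<gamma>)" using \<gamma> by (auto simp: \<delta>_def)
  have q: "q = 1 + 1 / (4 * \<gamma>) + 1 / (4 * \<gamma>)" "q \<ge> 1" using \<gamma> by (auto simp: q_def field_simps)
  have ind: "(\<Sum>b\<in>B. if b \<in> A then g b else 0) = (\<Sum>b\<in>A. g b)"
    if "A \<subseteq> B" for A and g :: "'b \<Rightarrow> real"
    using B that by (simp add: sum.inter_restrict[symmetric] Int_absorb1)
  have "\<delta> * (cmod ((if b \<in> M then x b else 0) - c b))\<^sup>2
      \<le> (1 + 4 * \<gamma>) * (if b \<in> B - M0 then (cmod (c b))\<^sup>2 else 0)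
        + q * (if b \<in> M0 then (cmod (z b))\<^sup>2 else 0)
        + q * (if b \<in> M then (cmod (z b))\<^sup>2 else 0)
        + (if b \<in> M0 then (cmod (x b))\<^sup>2 else 0)
        - (if b \<in> M then (cmod (x b))\<^sup>2 else 0)" if b: "b \<in> B" for b
  proof -
    have z0: "0 \<le> (cmod (z b))\<^sup>2" "0 \<le> (cmod (c b))\<^sup>2" by auto
    have m1: "\<delta> * (cmod (z b))\<^sup>2 \<le> 1 / (4 * \<gamma>) * (cmod (z b))\<^sup>2"
      "\<delta> * (cmod (z b))\<^sup>2 \<le> 1 / 2 * (cmod (z b))\<^sup>2" "1 * (cmod (z b))\<^sup>2 \<le> q * (cmod (z b))\<^sup>2"
      "\<delta> * (cmod (c b))\<^sup>2 \<le> 1 / 2 * (cmod (c b))\<^sup>2" "0 \<le> 4 * \<gamma> * (cmod (c b))\<^sup>2"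
      by (rule mult_right_mono[OF \<delta>(3) z0(1)], rule mult_right_mono[OF \<delta>(2) z0(1)],
        rule mult_right_mono[OF q(2) z0(1)], rule mult_right_mono[OF \<delta>(2) z0(2)])
        (use \<gamma> in simp)
    have e: "(1 + 4 * \<gamma>) * (cmod (c b))\<^sup>2 = (cmod (c b))\<^sup>2 + 4 * \<gamma> * (cmod (c b))\<^sup>2"
      by (simp add: algebra_simps)
    have qe: "q * (cmod (z b))\<^sup>2 = (1 + 1 / (4 * \<gamma>)) * (cmod (z b))\<^sup>2 + 1 / (4 * \<gamma>) * (cmod (z b))\<^sup>2"
      unfolding q(1) by (simp add: algebra_simps)
    consider "b \<in> M" "b \<in> M0" | "b \<in> M" "b \<notin> M0" | "b \<notin> M" "b \<in> M0" | "b \<notin> M" "b \<notin> M0" by blast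
    then show ?thesis
    proof cases
      case 1
      moreover have "\<delta> * (cmod (z b))\<^sup>2 \<le> q * (cmod (z b))\<^sup>2 + q * (cmod (z b))\<^sup>2"
        using m1 z0 by linarith
      ultimately show ?thesis using x[OF b] by simp
    next
      case 2
      \<comment> \<open>Young's inequality with parameter \<open>1 / (4 * \<gamma>)\<close> uses one
        half of the surplus \<open>q - 1\<close>; the other half pays for the loss, here
        \<open>\<delta>\<close> times the squared noise.\<close>
      have "(cmod (x b))\<^sup>2 \<le> (1 + 4 * \<gamma>) * (cmod (c b))\<^sup>2 + (1 + 1 / (4 * \<gamma>)) * (cmod (z b))\<^sup>2"
        using norm_add_sq_le[of "1 / (4 * \<gamma>)" "c b" "z b"] \<gamma> x[OF b] by simp
      moreover have "(if b \<in> M then x b else 0) - c b = z b" using 2 x[OF b] by simp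
      ultimately show ?thesis using 2 b m1 qe by simp
    next
      case 3
      \<comment> \<open>Here the loss is the missed signal \<open>x b - z b\<close>; the factor 2 is
        compensated by \<open>\<delta> \<le> 1 / 2\<close>.\<close>
      have "(cmod (c b))\<^sup>2 \<le> 2 * (cmod (x b))\<^sup>2 + 2 * (cmod (z b))\<^sup>2"
        using norm_add_sq_le[of 1 "x b" "- z b"] x[OF b] by simp
      then show ?thesis using 3 m1 by simp
    next
      case 4
      moreover have "\<delta> * (cmod (c b))\<^sup>2 \<le> (1 + 4 * \<gamma>) * (cmod (c b))\<^sup>2"
        using m1 e z0 by linarith
      ultimately show ?thesis using b by simp
    qed
  qed
  then have "(\<Sum>b\<in>B. \<delta> * (cmod ((if b \<in> M then x b else 0) - c b))\<^sup>2)
      \<le> (\<Sum>b\<in>B. (1 + 4 * \<gamma>) * (if b \<in> B - M0 then (cmod (c b))\<^sup>2 else 0)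
        + q * (if b \<in> M0 then (cmod (z b))\<^sup>2 else 0)
        + q * (if b \<in> M then (cmod (z b))\<^sup>2 else 0)
        + (if b \<in> M0 then (cmod (x b))\<^sup>2 else 0)
        - (if b \<in> M then (cmod (x b))\<^sup>2 else 0))"
    by (rule sum_mono)
  also have "\<dots> = (1 + 4 * \<gamma>) * (\<Sum>b\<in>B - M0. (cmod (c b))\<^sup>2)
      + q * (\<Sum>b\<in>M0. (cmod (z b))\<^sup>2) + q * (\<Sum>b\<in>M. (cmod (z b))\<^sup>2)
      + (\<Sum>b\<in>M0. (cmod (x b))\<^sup>2) - (\<Sum>b\<in>M. (cmod (x b))\<^sup>2)"
    unfolding sum.distrib sum_subtractf sum_distrib_left[symmetric]
    by (simp only: ind M M0 Diff_subset)
  finally show ?thesis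
    using opt unfolding \<delta>_def[symmetric] q_def[symmetric] sum_distrib_left[symmetric] by simp
qed

subsection \<open>Noise in the sequence model\<close>

lemma cas_00 [simp]: "cas n (0, 0) l = 1"
  by (simp add: cas_def)

lemma noise_law_eq: "noise_law d n \<sigma> = (\<Pi>\<^sub>M i\<in>lattice d n. gaussian \<sigma>)"
  by (simp add: noise_law_def)

lemma coef_measurable [measurable]: "(\<lambda>\<epsilon>. coef d n \<epsilon> b) \<in> borel_measurable (noise_law d n \<sigma>)"
  unfolding coef_def noise_law_eq by measurable

text \<open>Rescaled by the sample size over \<open>\<sigma>\<^sup>2\<close>, the noise energy in a
  model is a chi-square variable with twice the sum of the cut-points as degrees of freedom. This is
  seen through the Hartley coefficients, which are orthonormal for the noise covariance after
  division by \<open>\<sigma> * sqrt N\<close>.\<close>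

lemma noise_model_exp_moment:
  assumes s: "\<sigma> > 0" and N: "sample_size d n > 0" and adm: "admissible d n J \<kappa>"
    and u: "0 \<le> u" "u < 1 / 2"
  shows "(\<integral>\<^sup>+\<epsilon>. ennreal (exp (u * (real (sample_size d n) / \<sigma>\<^sup>2 *
      (\<Sum>b\<in>model J \<kappa>. (cmod (coef d n \<epsilon> b))\<^sup>2)))) \<partial>noise_law d n \<sigma>)
    = ennreal ((1 / (1 - 2 * u)) ^ (\<Sum>j\<in>J. \<kappa> j))"
proof -
  let ?N = "real (sample_size d n)"
  have J: "finite J" by (rule admissible_finite[OF adm])
  define A where "A = (\<lambda>b l. cas n b l / (\<sigma> * sqrt ?N))"
  have sub: "model J \<kappa> \<subseteq> freqs0 d n"
    using model_subset_freqs[OF adm] freqs_subset_freqs0 by blast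
  have "\<sigma>\<^sup>2 * (\<Sum>l\<in>lattice d n. A b l * A b' l) = (if b = b' then 1 else 0)"
    if "b \<in> model J \<kappa>" "b' \<in> model J \<kappa>" for b b'
  proof -
    have "\<sigma>\<^sup>2 * (\<Sum>l\<in>lattice d n. A b l * A b' l) = (\<Sum>l\<in>lattice d n. cas n b l * cas n b' l) / ?N"
      using s N by (simp add: A_def sum_distrib_left sum_divide_distrib power2_eq_square)
    moreover have "b \<in> freqs0 d n" "b' \<in> freqs0 d n" using that sub by auto
    ultimately show ?thesis using N by (simp add: cas_orthogonal)
  qed
  note * = PiM_gaussian_exp_quadratic[OF s finite_lattice finite_model[OF J] u this]
  have "?N / \<sigma>\<^sup>2 * (\<Sum>b\<in>model J \<kappa>. (cmod (coef d n \<epsilon> b))\<^sup>2)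
      = (\<Sum>b\<in>model J \<kappa>. (\<Sum>l\<in>lattice d n. A b l * \<epsilon> l)\<^sup>2)" for \<epsilon>
  proof -
    have "?N / \<sigma>\<^sup>2 * ((\<Sum>l\<in>lattice d n. cas n b l * \<epsilon> l) / ?N)\<^sup>2 = (\<Sum>l\<in>lattice d n. A b l * \<epsilon> l)\<^sup>2" for b
    proof -
      have "(\<Sum>l\<in>lattice d n. A b l * \<epsilon> l) = (\<Sum>l\<in>lattice d n. cas n b l * \<epsilon> l) / (\<sigma> * sqrt ?N)"
        by (simp add: A_def sum_divide_distrib)
      then show ?thesis using s N by (simp add: power_divide power_mult_distrib) (simp add: power2_eq_square)
    qed
    then show ?thesis unfolding sum_coef_model_eq_cas[OF J] by (simp add: sum_distrib_left)
  qed
  then show ?thesis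
    unfolding noise_law_eq using * u by (simp add: card_model[OF J] power_mult power_divide)
qed

lemma noise_cas_second_moment:
  assumes s: "\<sigma> > 0" and N: "sample_size d n > 0" and b: "b \<in> freqs0 d n"
  shows "(\<integral>\<^sup>+\<epsilon>. ennreal (((\<Sum>l\<in>lattice d n. cas n b l * \<epsilon> l) / real (sample_size d n))\<^sup>2) \<partial>noise_law d n \<sigma>)
    \<le> ennreal (6 * \<sigma>\<^sup>2 / real (sample_size d n))"
proof -
  let ?N = "real (sample_size d n)"
  define a where "a = (\<lambda>l. cas n b l / (\<sigma> * sqrt ?N))"
  have "\<sigma>\<^sup>2 * (\<Sum>l\<in>lattice d n. (a l)\<^sup>2) = (\<Sum>l\<in>lattice d n. cas n b l * cas n b l) / ?N"
    using s N by (simp add: a_def sum_distrib_left sum_divide_distrib power2_eq_square)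
  also have "\<dots> = 1" using N by (simp add: cas_orthogonal[OF b b])
  finally have *: "\<sigma>\<^sup>2 * (\<Sum>l\<in>lattice d n. (a l)\<^sup>2) = 1" .
  have eq: "((\<Sum>l\<in>lattice d n. cas n b l * \<epsilon> l) / ?N)\<^sup>2 = \<sigma>\<^sup>2 / ?N * (\<Sum>l\<in>lattice d n. a l * \<epsilon> l)\<^sup>2" for \<epsilon>
  proof -
    have "(\<Sum>l\<in>lattice d n. a l * \<epsilon> l) = (\<Sum>l\<in>lattice d n. cas n b l * \<epsilon> l) / (\<sigma> * sqrt ?N)"
      by (simp add: a_def sum_divide_distrib)
    then show ?thesis using s N by (simp add: power_divide power_mult_distrib) (simp add: power2_eq_square)
  qed
  have "(\<integral>\<^sup>+\<epsilon>. ennreal (((\<Sum>l\<in>lattice d n. cas n b l * \<epsilon> l) / ?N)\<^sup>2) \<partial>noise_law d n \<sigma>)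
      = ennreal (\<sigma>\<^sup>2 / ?N) * (\<integral>\<^sup>+\<epsilon>. ennreal ((\<Sum>l\<in>lattice d n. a l * \<epsilon> l)\<^sup>2) \<partial>noise_law d n \<sigma>)"
    unfolding eq by (subst nn_integral_cmult[symmetric]) (auto simp: ennreal_mult[symmetric] noise_law_eq)
  also have "\<dots> \<le> ennreal (\<sigma>\<^sup>2 / ?N) * 6"
    unfolding noise_law_eq by (intro mult_left_mono PiM_gaussian_second_moment[OF s _ *]) auto
  also have "\<dots> = ennreal (6 * \<sigma>\<^sup>2 / ?N)"
    by (simp add: ennreal_mult[symmetric] mult.commute flip: ennreal_numeral)
  finally show ?thesis .
qed

lemma noise_model_second_moment:
  assumes s: "\<sigma> > 0" and N: "sample_size d n > 0" and adm: "admissible d n J \<kappa>"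
  shows "(\<integral>\<^sup>+\<epsilon>. ennreal (\<Sum>b\<in>model J \<kappa>. (cmod (coef d n \<epsilon> b))\<^sup>2) \<partial>noise_law d n \<sigma>)
    \<le> ennreal (12 * \<sigma>\<^sup>2 / real (sample_size d n) * real (\<Sum>j\<in>J. \<kappa> j))"
proof -
  let ?H = "\<lambda>b \<epsilon>. ((\<Sum>l\<in>lattice d n. cas n b l * \<epsilon> l) / real (sample_size d n))\<^sup>2"
  have J: "finite J" by (rule admissible_finite[OF adm])
  have sub: "model J \<kappa> \<subseteq> freqs0 d n"
    using model_subset_freqs[OF adm] freqs_subset_freqs0 by blast
  have "(\<integral>\<^sup>+\<epsilon>. ennreal (\<Sum>b\<in>model J \<kappa>. (cmod (coef d n \<epsilon> b))\<^sup>2) \<partial>noise_law d n \<sigma>)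
      = (\<integral>\<^sup>+\<epsilon>. (\<Sum>b\<in>model J \<kappa>. ennreal (?H b \<epsilon>)) \<partial>noise_law d n \<sigma>)"
    unfolding sum_coef_model_eq_cas[OF J] by (simp add: sum_ennreal)
  also have "\<dots> = (\<Sum>b\<in>model J \<kappa>. \<integral>\<^sup>+\<epsilon>. ennreal (?H b \<epsilon>) \<partial>noise_law d n \<sigma>)"
    by (rule nn_integral_sum) (simp add: noise_law_eq)
  also have "\<dots> \<le> (\<Sum>b\<in>model J \<kappa>. ennreal (6 * \<sigma>\<^sup>2 / real (sample_size d n)))"
    using sub by (intro sum_mono noise_cas_second_moment[OF s N]) blast
  also have "\<dots> = ennreal (12 * \<sigma>\<^sup>2 / real (sample_size d n) * real (\<Sum>j\<in>J. \<kappa> j))"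
    by (simp add: sum_ennreal card_model[OF J] mult_ac ennreal_of_nat_eq_real_of_nat
        flip: ennreal_mult del: sum_constant)
      (simp add: card_model[OF J] mult_ac)
  finally show ?thesis .
qed

section \<open>Exponential moments summed over all models\<close>

definition models :: "nat \<Rightarrow> (nat \<Rightarrow> nat) \<Rightarrow> (nat set \<times> (nat \<Rightarrow> nat)) set" where
  "models d n = (SIGMA J:Pow {1..d}. \<Pi>\<^sub>E j\<in>J. {1..(n j - 1) div 2})"

lemma finite_models: "finite (models d n)"
  unfolding models_def by (intro finite_SigmaI finite_PiE) (auto intro: finite_subset)

lemma models_admissible: "(J, \<kappa>) \<in> models d n \<Longrightarrow> admissible d n J \<kappa>"
  by (auto simp: models_def admissible_def PiE_def Pi_def)

text \<open>Admissibility leaves the cut-points outside \<open>J\<close> free; restriction picks one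
  representative, so that sums over models are finite and no model is counted twice.\<close>

lemma restrict_in_models: "admissible d n J \<kappa> \<Longrightarrow> (J, restrict \<kappa> J) \<in> models d n"
  by (auto simp: models_def admissible_def)

text \<open>The factors \<open>2 ^ \<kappa> j\<close> are the price of using the constant \<open>1 + 1 / (2 \<gamma>) > 1\<close> in front of the
  noise; the decay of \<open>\<pi> j\<close> pays for them.\<close>

definition prior_weight ::
  "nat \<Rightarrow> nat pmf \<Rightarrow> (nat \<Rightarrow> nat pmf) \<Rightarrow> nat set \<Rightarrow> (nat \<Rightarrow> nat) \<Rightarrow> real" where
  "prior_weight d \<pi>0 \<pi> J \<kappa>
    = pmf \<pi>0 (card J) / real (d choose card J) * (\<Prod>j\<in>J. pmf (\<pi> j) (\<kappa> j) * 2 ^ \<kappa> j)"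

lemma sum_half_powers_le: "(\<Sum>k=1..m. (1 / 2) ^ k) \<le> (1 :: real)"
proof -
  have "(\<Sum>k=1..m. (1 / 2) ^ k) = 1 - (1 / 2 :: real) ^ m"
    by (induction m) auto
  then show ?thesis by simp
qed

text \<open>For fixed \<open>J\<close> the sum over cut-points factorizes over \<open>j\<close>, and
  each factor is at most the geometric sum of \<open>(1 / 2) ^ k\<close>. The sets of size
  \<open>h\<close> then cancel the binomial coefficient and leave the mass of \<open>h\<close> under
  \<open>\<pi>0\<close>.\<close>

lemma sum_prior_weight_le:
  assumes "\<And>j k. j \<in> {1..d} \<Longrightarrow> k \<in> {1..(n j - 1) div 2} \<Longrightarrow> pmf (\<pi> j) k \<le> (1 / 4) ^ k"
  shows "(\<Sum>(J, \<kappa>)\<in>models d n. prior_weight d \<pi>0 \<pi> J \<kappa>) \<le> 1"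
proof -
  have "(\<Sum>(J, \<kappa>)\<in>models d n. prior_weight d \<pi>0 \<pi> J \<kappa>)
      = (\<Sum>J\<in>Pow {1..d}. pmf \<pi>0 (card J) / real (d choose card J) *
          (\<Sum>\<kappa>\<in>(\<Pi>\<^sub>E j\<in>J. {1..(n j - 1) div 2}). \<Prod>j\<in>J. pmf (\<pi> j) (\<kappa> j) * 2 ^ \<kappa> j))"
    unfolding models_def prior_weight_def
    by (subst sum.Sigma[symmetric])
      (auto simp: sum_distrib_left intro!: finite_PiE intro: finite_subset)
  also have "\<dots> \<le> (\<Sum>J\<in>Pow {1..d}. pmf \<pi>0 (card J) / real (d choose card J) * 1)"
  proof (intro sum_mono mult_left_mono)
    fix J assume J: "J \<in> Pow {1..d}"
    then have fJ: "finite J" by (auto intro: finite_subset)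
    have "(\<Sum>\<kappa>\<in>(\<Pi>\<^sub>E j\<in>J. {1..(n j - 1) div 2}). \<Prod>j\<in>J. pmf (\<pi> j) (\<kappa> j) * 2 ^ \<kappa> j)
        = (\<Prod>j\<in>J. \<Sum>k=1..(n j - 1) div 2. pmf (\<pi> j) k * 2 ^ k)"
      using fJ by (subst prod_sum_PiE) auto
    also have "\<dots> \<le> 1"
    proof (rule prod_le_1, safe)
      fix j assume j: "j \<in> J"
      show "0 \<le> (\<Sum>k=1..(n j - 1) div 2. pmf (\<pi> j) k * 2 ^ k)"
        by (intro sum_nonneg) simp
      have "(\<Sum>k=1..(n j - 1) div 2. pmf (\<pi> j) k * 2 ^ k) \<le> (\<Sum>k=1..(n j - 1) div 2. (1 / 2) ^ k)"
      proof (rule sum_mono)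
        fix k assume "k \<in> {1..(n j - 1) div 2}"
        then have "pmf (\<pi> j) k * 2 ^ k \<le> (1 / 4) ^ k * 2 ^ k"
          using assms j J by (intro mult_right_mono) auto
        then show "pmf (\<pi> j) k * 2 ^ k \<le> (1 / 2) ^ k"
          by (simp add: power_mult_distrib[symmetric])
      qed
      also have "\<dots> \<le> 1" by (rule sum_half_powers_le)
      finally show "(\<Sum>k=1..(n j - 1) div 2. pmf (\<pi> j) k * 2 ^ k) \<le> 1" .
    qed
    finally show "(\<Sum>\<kappa>\<in>(\<Pi>\<^sub>E j\<in>J. {1..(n j - 1) div 2}). \<Prod>j\<in>J. pmf (\<pi> j) (\<kappa> j) * 2 ^ \<kappa> j) \<le> 1" .
  qed auto
  also have "\<dots> = (\<Sum>h\<in>{0..d}. \<Sum>J | J \<in> Pow {1..d} \<and> card J = h. pmf \<pi>0 (card J) / real (d choose card J))"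
    unfolding mult_1_right
    by (rule sum.group[symmetric]) (auto dest: card_mono[rotated])
  also have "\<dots> = (\<Sum>h\<in>{0..d}. pmf \<pi>0 h)"
  proof (rule sum.cong[OF refl])
    fix h assume h: "h \<in> {0..d}"
    have "card {J. J \<in> Pow {1..d} \<and> card J = h} = d choose h"
      using n_subsets[of "{1..d}" h] by simp
    then show "(\<Sum>J | J \<in> Pow {1..d} \<and> card J = h. pmf \<pi>0 (card J) / real (d choose card J)) = pmf \<pi>0 h"
      using h by simp
  qed
  also have "\<dots> \<le> 1"
    by (simp add: measure_measure_pmf_finite[symmetric])
  finally show ?thesis .
qed

lemma exp_neg_ln_inverse: "p > 0 \<Longrightarrow> x > 0 \<Longrightarrow> exp (- ln (inverse p * x)) = p / x"
  for p x :: real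
  by (simp add: exp_minus field_simps)

text \<open>The exponential splits into a deterministic factor, where the penalties turn into prior
  masses divided by the binomial coefficient and by powers of \<open>1 + \<gamma>\<close>, and a
  chi-square moment equal to a power of \<open>2 * (1 + \<gamma>)\<close>. The powers of
  \<open>1 + \<gamma>\<close> cancel.\<close>

lemma model_deviation_exp_moment:
  fixes \<sigma> \<gamma> :: real
  assumes s: "\<sigma> > 0" and g: "\<gamma> > 0" and N: "sample_size d n > 0" and adm: "admissible d n J \<kappa>"
    and p0: "\<And>h. h \<le> d \<Longrightarrow> pmf \<pi>0 h > 0"
    and p: "\<And>j k. j \<in> {1..d} \<Longrightarrow> k \<in> {1..(n j - 1) div 2} \<Longrightarrow> pmf (\<pi> j) k > 0"
  shows "(\<integral>\<^sup>+\<epsilon>. ennreal (exp (\<gamma> / (2 * (1 + \<gamma>)) * (real (sample_size d n) / \<sigma>\<^sup>2 *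
      ((1 + 1 / (2 * \<gamma>)) * (\<Sum>b\<in>model J \<kappa>. (cmod (coef d n \<epsilon> b))\<^sup>2)
        - model_pen d n \<sigma> \<gamma> \<pi>0 \<pi> J \<kappa>)))) \<partial>noise_law d n \<sigma>)
    = ennreal (prior_weight d \<pi>0 \<pi> J \<kappa>)"
proof -
  let ?N = "real (sample_size d n)"
  define t where "t = \<gamma> / (2 * (1 + \<gamma>))"
  define u where "u = (1 + 2 * \<gamma>) / (4 * (1 + \<gamma>))"
  have tu: "t * (1 + 1 / (2 * \<gamma>)) = u" 
  proof -
    have "1 + 1 / (2 * \<gamma>) = (1 + 2 * \<gamma>) / (2 * \<gamma>)" using g by (simp add: field_simps)
    then show ?thesis using g by (simp add: t_def u_def)
  qed
  have u: "0 \<le> u" "u < 1 / 2" and u2: "1 / (1 - 2 * u) = 2 * (1 + \<gamma>)"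
    using g by (auto simp: u_def field_simps)
  have J: "finite J" "J \<subseteq> {1..d}" using admissible_finite[OF adm] adm by (auto simp: admissible_def)
  have cJ: "card J \<le> d" using card_mono[OF _ J(2)] by simp
  have pos: "pmf (\<pi> j) (\<kappa> j) > 0" if "j \<in> J" for j
    using that adm p by (auto simp: admissible_def)
  define w where "w = 2 * \<sigma>\<^sup>2 / ?N * (1 + 1 / \<gamma>)"
  have tw: "t * (?N / \<sigma>\<^sup>2 * (w * L)) = L" for L
  proof -
    have "1 + 1 / \<gamma> = (1 + \<gamma>) / \<gamma>" using g by (simp add: field_simps)
    then show ?thesis using s g N by (simp add: t_def w_def) (simp add: field_simps)
  qed
  have pen: "t * (?N / \<sigma>\<^sup>2 * model_pen d n \<sigma> \<gamma> \<pi>0 \<pi> J \<kappa>)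
      = (\<Sum>j\<in>J. ln (inverse (pmf (\<pi> j) (\<kappa> j)) * (1 + \<gamma>) ^ \<kappa> j))
        + ln (inverse (pmf \<pi>0 (card J)) * real (d choose card J))"
    unfolding model_pen_def Penj_def Pen0_def w_def[symmetric]
    unfolding distrib_left sum_distrib_left tw ..
  have exp_pen: "exp (- (t * (?N / \<sigma>\<^sup>2 * model_pen d n \<sigma> \<gamma> \<pi>0 \<pi> J \<kappa>)))
      = (\<Prod>j\<in>J. pmf (\<pi> j) (\<kappa> j) / (1 + \<gamma>) ^ \<kappa> j) * (pmf \<pi>0 (card J) / real (d choose card J))"
  proof -
    have "exp (- (t * (?N / \<sigma>\<^sup>2 * model_pen d n \<sigma> \<gamma> \<pi>0 \<pi> J \<kappa>)))
      = (\<Prod>j\<in>J. exp (- ln (inverse (pmf (\<pi> j) (\<kappa> j)) * (1 + \<gamma>) ^ \<kappa> j)))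
        * exp (- ln (inverse (pmf \<pi>0 (card J)) * real (d choose card J)))"
      unfolding pen minus_add_distrib exp_add sum_negf[symmetric] exp_sum[OF J(1)] ..
    also have "exp (- ln (inverse (pmf \<pi>0 (card J)) * real (d choose card J)))
        = pmf \<pi>0 (card J) / real (d choose card J)"
      using p0[OF cJ] cJ by (intro exp_neg_ln_inverse) auto
    also have "(\<Prod>j\<in>J. exp (- ln (inverse (pmf (\<pi> j) (\<kappa> j)) * (1 + \<gamma>) ^ \<kappa> j)))
        = (\<Prod>j\<in>J. pmf (\<pi> j) (\<kappa> j) / (1 + \<gamma>) ^ \<kappa> j)"
      using g pos by (intro prod.cong refl exp_neg_ln_inverse) auto
    finally show ?thesis .
  qed
  define E where "E = exp (- (t * (?N / \<sigma>\<^sup>2 * model_pen d n \<sigma> \<gamma> \<pi>0 \<pi> J \<kappa>)))"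
  have split: "exp (t * (?N / \<sigma>\<^sup>2 * ((1 + 1 / (2 * \<gamma>)) * S - model_pen d n \<sigma> \<gamma> \<pi>0 \<pi> J \<kappa>)))
      = E * exp (u * (?N / \<sigma>\<^sup>2 * S))" for S
    unfolding E_def mult_exp_exp tu[symmetric] by (simp add: algebra_simps)
  have "(\<integral>\<^sup>+\<epsilon>. ennreal (exp (t * (?N / \<sigma>\<^sup>2 *
      ((1 + 1 / (2 * \<gamma>)) * (\<Sum>b\<in>model J \<kappa>. (cmod (coef d n \<epsilon> b))\<^sup>2)
        - model_pen d n \<sigma> \<gamma> \<pi>0 \<pi> J \<kappa>)))) \<partial>noise_law d n \<sigma>)
      = ennreal E * (\<integral>\<^sup>+\<epsilon>. ennreal (exp (u * (?N / \<sigma>\<^sup>2 *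
          (\<Sum>b\<in>model J \<kappa>. (cmod (coef d n \<epsilon> b))\<^sup>2)))) \<partial>noise_law d n \<sigma>)"
    unfolding split
    by (subst nn_integral_cmult[symmetric]) (measurable, simp add: ennreal_mult E_def)
  also have "\<dots> = ennreal (E * (2 * (1 + \<gamma>)) ^ (\<Sum>j\<in>J. \<kappa> j))"
    unfolding noise_model_exp_moment[OF s N adm u] u2 using g by (simp add: ennreal_mult E_def)
  also have "E * (2 * (1 + \<gamma>)) ^ (\<Sum>j\<in>J. \<kappa> j) = prior_weight d \<pi>0 \<pi> J \<kappa>"
  proof -
    have "(\<Prod>j\<in>J. pmf (\<pi> j) (\<kappa> j) / (1 + \<gamma>) ^ \<kappa> j) * (2 * (1 + \<gamma>)) ^ (\<Sum>j\<in>J. \<kappa> j)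
        = (\<Prod>j\<in>J. pmf (\<pi> j) (\<kappa> j) * 2 ^ \<kappa> j)"
      unfolding power_sum prod.distrib[symmetric]
      using g by (intro prod.cong refl) (simp only: power_mult_distrib, simp)
    then show ?thesis
      unfolding E_def exp_pen prior_weight_def by (simp add: mult_ac)
  qed
  finally show ?thesis unfolding t_def .
qed

subsection \<open>The oracle inequality\<close>

text \<open>Masses are at most 1, so each logarithm is taken of a number at least 1. Nonnegativity
  is what allows the bound on the risk to be split into summands in \<open>ennreal\<close>.\<close>

lemma model_pen_nonneg:
  assumes g: "\<gamma> > 0" and adm: "admissible d n J \<kappa>"
    and p0: "\<And>h. h \<le> d \<Longrightarrow> pmf \<pi>0 h > 0"
    and p: "\<And>j k. j \<in> {1..d} \<Longrightarrow> k \<in> {1..(n j - 1) div 2} \<Longrightarrow> pmf (\<pi> j) k > 0"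
  shows "model_pen d n \<sigma> \<gamma> \<pi>0 \<pi> J \<kappa> \<ge> 0"
proof -
  have ge: "ln (inverse (pmf r k) * x) \<ge> 0" if "pmf r k > 0" "x \<ge> 1" for r :: "nat pmf" and k x
  proof -
    have "1 * 1 \<le> inverse (pmf r k) * x"
      using that by (intro mult_mono) (auto simp: pmf_le_1 intro: one_le_inverse)
    then show ?thesis by simp
  qed
  have J: "J \<subseteq> {1..d}" using adm by (simp add: admissible_def)
  have cJ: "card J \<le> d" using card_mono[OF _ J] by simp
  have "Penj d n \<sigma> \<gamma> (\<pi> j) (\<kappa> j) \<ge> 0" if "j \<in> J" for j
    unfolding Penj_def using that adm p g
    by (intro mult_nonneg_nonneg ge) (auto simp: admissible_def)
  moreover have "Pen0 d n \<sigma> \<gamma> \<pi>0 (card J) \<ge> 0"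
    unfolding Pen0_def using g p0[OF cJ] cJ
    by (intro mult_nonneg_nonneg ge) (auto simp: Suc_le_eq)
  ultimately show ?thesis
    unfolding model_pen_def by (intro add_nonneg_nonneg sum_nonneg)
qed

text \<open>The fixed competitor enters only through the mean of its noise energy; exponential
  moments serve the selected model alone. The pointwise bound no longer mentions the selected model,
  so it can be integrated term by term.\<close>

lemma oracle_inequality:
  fixes \<sigma> \<gamma> a0 :: real and n :: "nat \<Rightarrow> nat" and f :: "nat \<Rightarrow> real \<Rightarrow> real"
  assumes s: "\<sigma> > 0" and g: "\<gamma> > 0"
    and odd: "\<And>j. j \<in> {1..d} \<Longrightarrow> odd (n j)"
    and c0: "\<And>j. j \<in> {1..d} \<Longrightarrow> fourier_coeff (n j) (f j) 0 = 0"
    and p0: "\<And>h. h \<le> d \<Longrightarrow> pmf \<pi>0 h > 0"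
    and p: "\<And>j k. j \<in> {1..d} \<Longrightarrow> k \<in> {1..(n j - 1) div 2} \<Longrightarrow> pmf (\<pi> j) k > 0"
    and p4: "\<And>j k. j \<in> {1..d} \<Longrightarrow> k \<in> {1..(n j - 1) div 2} \<Longrightarrow> pmf (\<pi> j) k \<le> (1 / 4) ^ k"
    and MAP: "MAP_selection d n \<sigma> \<gamma> \<pi>0 \<pi> Jhat khat"
    and adm: "admissible d n J \<kappa>"
  shows "AMSE d n \<sigma> Jhat khat a0 f
    \<le> ennreal (6 * \<sigma>\<^sup>2 / real (sample_size d n) + 1 / min (1 / 2) (1 / (4 * \<gamma>)) *
        ((1 + 4 * \<gamma>) * (\<Sum>b\<in>freqs d n - model J \<kappa>. (cmod (theta n a0 f b))\<^sup>2)
          + model_pen d n \<sigma> \<gamma> \<pi>0 \<pi> J \<kappa>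
          + (1 + 1 / (2 * \<gamma>)) * (12 * \<sigma>\<^sup>2 / real (sample_size d n) * real (\<Sum>j\<in>J. \<kappa> j))
          + 2 * (1 + \<gamma>) / \<gamma> * (\<sigma>\<^sup>2 / real (sample_size d n))))"
proof -
  let ?N = "real (sample_size d n)"
  let ?P = "noise_law d n \<sigma>"
  let ?pen = "model_pen d n \<sigma> \<gamma> \<pi>0 \<pi>"
  define \<delta> where "\<delta> = min (1 / 2) (1 / (4 * \<gamma>))"
  define q where "q = 1 + 1 / (2 * \<gamma>)"
  define t where "t = \<gamma> / (2 * (1 + \<gamma>))"
  define \<tau> where "\<tau> = t * (?N / \<sigma>\<^sup>2)"
  define A where "A = (1 + 4 * \<gamma>) * (\<Sum>b\<in>freqs d n - model J \<kappa>. (cmod (theta n a0 f b))\<^sup>2) + ?pen J \<kappa>"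
  define S where "S = (\<lambda>M \<epsilon>. \<Sum>b\<in>M. (cmod (coef d n \<epsilon> b))\<^sup>2)"
  define X where "X = (\<lambda>(J, \<kappa>) \<epsilon>. exp (t * (?N / \<sigma>\<^sup>2 * (q * S (model J \<kappa>) \<epsilon> - ?pen J \<kappa>))))"
  have Nn: "sample_size d n > 0" by (rule sample_size_pos) (use odd odd_pos in blast)
  have np: "n j > 0" if "j \<in> {1..d}" for j using odd odd_pos that by blast
  have pos: "\<delta> > 0" "q > 0" "t > 0" "\<tau> > 0" 
    using g s Nn by (auto simp: \<delta>_def q_def t_def \<tau>_def intro!: add_pos_pos)
  have A: "A \<ge> 0"
    unfolding A_def using g by (intro add_nonneg_nonneg mult_nonneg_nonneg sum_nonneg
        model_pen_nonneg[OF g adm p0 p]) auto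
  have pointwise: "1 / ?N * (\<Sum>l\<in>lattice d n. (cmod (fhat d n Jhat khat (observations d n a0 f \<epsilon>) l
          - of_real (additive_fun d a0 f (grid_point n l))))\<^sup>2)
      \<le> (cmod (coef d n \<epsilon> (0, 0)))\<^sup>2
        + (1 / \<delta> * A + (q / \<delta> * S (model J \<kappa>) \<epsilon> + 1 / (\<delta> * \<tau>) * (\<Sum>m\<in>models d n. X m \<epsilon>)))" for \<epsilon>
  proof -
    define y where "y = observations d n a0 f \<epsilon>"
    define K where "K = khat y"
    define J' where "J' = Jhat y"
    have "y \<in> space (data_space d n)"
      by (simp add: y_def observations_def data_space_def space_PiM)
    then have adm': "admissible d n J' K"
      and opt: "MAP_criterion d n \<sigma> \<gamma> \<pi>0 \<pi> y J' K \<le> MAP_criterion d n \<sigma> \<gamma> \<pi>0 \<pi> y J \<kappa>"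
      using MAP adm unfolding MAP_selection_def J'_def K_def by blast+
    have sub: "J' \<subseteq> {1..d}" "J \<subseteq> {1..d}" using adm adm' by (auto simp: admissible_def)
    have opt': "?pen J' K - (\<Sum>b\<in>model J' K. (cmod (coef d n y b))\<^sup>2)
        \<le> ?pen J \<kappa> - (\<Sum>b\<in>model J \<kappa>. (cmod (coef d n y b))\<^sup>2)"
    proof -
      have "MAP_criterion d n \<sigma> \<gamma> \<pi>0 \<pi> y J1 K1
          = ?pen J1 K1 - (\<Sum>b\<in>model J1 K1. (cmod (coef d n y b))\<^sup>2)"
        if "J1 \<subseteq> {1..d}" for J1 K1
        by (rule MAP_criterion_eq[OF that]) (rule np)
      with opt sub show ?thesis by simp
    qed
    have x: "coef d n y b = theta n a0 f b + coef d n \<epsilon> b" if "b \<in> freqs d n" for b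
    proof -
      have "b \<in> freqs0 d n" using that freqs_subset_freqs0 by blast
      from coef_observations[OF odd c0 this] show ?thesis by (simp add: y_def)
    qed
    have "\<delta> * (\<Sum>b\<in>freqs d n. (cmod (model_coef d n J' K y b - theta n a0 f b))\<^sup>2)
      \<le> A + q * S (model J \<kappa>) \<epsilon> + (q * S (model J' K) \<epsilon> - ?pen J' K)"
      using projection_oracle[of \<gamma> "freqs d n" "model J' K" "model J \<kappa>" "coef d n y" "theta n a0 f"
          "coef d n \<epsilon>", OF g finite_freqs model_subset_freqs[OF adm'] model_subset_freqs[OF adm]
          x opt']
      by (simp add: \<delta>_def q_def S_def A_def model_coef_def)
    \<comment> \<open>By \<open>x \<le> exp x\<close>, and because the selected model is one of
      finitely many, the random choice is absorbed by summing the exponentials over all of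
      them.\<close>
    also have "q * S (model J' K) \<epsilon> - ?pen J' K \<le> 1 / \<tau> * (\<Sum>m\<in>models d n. X m \<epsilon>)"
    proof -
      let ?m = "(J', restrict K J')"
      have m: "model J' (restrict K J') = model J' K" "?pen J' (restrict K J') = ?pen J' K"
        by (auto simp: model_def model_pen_def intro!: sum.cong)
      have "\<tau> * (q * S (model J' K) \<epsilon> - ?pen J' K) \<le> exp (\<tau> * (q * S (model J' K) \<epsilon> - ?pen J' K))"
        using exp_ge_add_one_self[of "\<tau> * (q * S (model J' K) \<epsilon> - ?pen J' K)"] by linarith
      also have "\<dots> = X ?m \<epsilon>" by (simp add: X_def m \<tau>_def mult.assoc)
      also have "\<dots> \<le> (\<Sum>m\<in>models d n. X m \<epsilon>)"
        by (rule member_le_sum[OF restrict_in_models[OF adm'] _ finite_models]) (auto simp: X_def)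
      finally show ?thesis using pos by (simp add: field_simps)
    qed
    finally have "(\<Sum>b\<in>freqs d n. (cmod (model_coef d n J' K y b - theta n a0 f b))\<^sup>2)
        \<le> 1 / \<delta> * (A + q * S (model J \<kappa>) \<epsilon> + 1 / \<tau> * (\<Sum>m\<in>models d n. X m \<epsilon>))"
      using pos by (simp add: field_simps)
    also have "\<dots> = 1 / \<delta> * A + (q / \<delta> * S (model J \<kappa>) \<epsilon> + 1 / (\<delta> * \<tau>) * (\<Sum>m\<in>models d n. X m \<epsilon>))"
      by (simp add: algebra_simps add_divide_distrib)
    finally show ?thesis
      using loss_eq[where d = d and n = n and f = f and Jhat = Jhat and khat = khat and ?a0.0 = a0
          and \<epsilon> = \<epsilon>, OF odd c0] by (simp add: J'_def K_def y_def)
  qed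
  have meas0 [measurable]: "(\<lambda>\<epsilon>. ennreal ((cmod (coef d n \<epsilon> (0, 0)))\<^sup>2)) \<in> borel_measurable ?P"
    by (rule measurable_compose[OF coef_measurable]) measurable
  have measS [measurable]: "(\<lambda>\<epsilon>. S M \<epsilon>) \<in> borel_measurable ?P" for M
    unfolding S_def
    by (intro borel_measurable_sum measurable_compose[OF coef_measurable, of "\<lambda>x. (cmod x)\<^sup>2"]) measurable
  have measX [measurable]: "(\<lambda>\<epsilon>. ennreal (X m \<epsilon>)) \<in> borel_measurable ?P" for m
  proof -
    obtain J1 \<kappa>1 where "m = (J1, \<kappa>1)" by (cases m)
    then show ?thesis by (simp add: X_def)
  qed
  have X0: "X m \<epsilon> \<ge> 0" for m \<epsilon> by (cases m) (simp add: X_def)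
  have S0: "S M \<epsilon> \<ge> 0" for M \<epsilon> by (simp add: S_def sum_nonneg)
  have P1: "emeasure ?P (space ?P) = 1"
    unfolding noise_law_eq by (rule prob_space.emeasure_space_1[OF prob_space_PiM_gaussian[OF s]])
  have I0: "(\<integral>\<^sup>+\<epsilon>. ennreal ((cmod (coef d n \<epsilon> (0, 0)))\<^sup>2) \<partial>?P) \<le> ennreal (6 * \<sigma>\<^sup>2 / ?N)"
  proof -
    have b: "(0, 0) \<in> freqs0 d n" by (simp add: freqs0_def)
    have "coef d n \<epsilon> (0, 0) = complex_of_real ((\<Sum>l\<in>lattice d n. cas n (0, 0) l * \<epsilon> l) / ?N)" for \<epsilon>
      by (simp add: coef_def)
    then have "(cmod (coef d n \<epsilon> (0, 0)))\<^sup>2 = ((\<Sum>l\<in>lattice d n. cas n (0, 0) l * \<epsilon> l) / ?N)\<^sup>2" for \<epsilon>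
      by (simp only: norm_of_real power2_abs)
    then show ?thesis using noise_cas_second_moment[OF s Nn b] by (simp only:)
  qed
  have IX: "(\<integral>\<^sup>+\<epsilon>. (\<Sum>m\<in>models d n. ennreal (X m \<epsilon>)) \<partial>?P) \<le> 1"
  proof -
    have "(\<integral>\<^sup>+\<epsilon>. (\<Sum>m\<in>models d n. ennreal (X m \<epsilon>)) \<partial>?P)
        = (\<Sum>m\<in>models d n. \<integral>\<^sup>+\<epsilon>. ennreal (X m \<epsilon>) \<partial>?P)"
      by (rule nn_integral_sum) (rule measX)
    also have "\<dots> = (\<Sum>m\<in>models d n. ennreal (case m of (J, \<kappa>) \<Rightarrow> prior_weight d \<pi>0 \<pi> J \<kappa>))"
    proof (rule sum.cong[OF refl])
      fix m assume m: "m \<in> models d n"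
      obtain J1 \<kappa>1 where m1: "m = (J1, \<kappa>1)" by (cases m)
      show "(\<integral>\<^sup>+\<epsilon>. ennreal (X m \<epsilon>) \<partial>?P) = ennreal (case m of (J, \<kappa>) \<Rightarrow> prior_weight d \<pi>0 \<pi> J \<kappa>)"
        using model_deviation_exp_moment[OF s g Nn models_admissible[OF m[unfolded m1]] p0 p]
        by (simp add: m1 X_def S_def t_def q_def)
    qed
    also have "\<dots> = ennreal (\<Sum>(J, \<kappa>)\<in>models d n. prior_weight d \<pi>0 \<pi> J \<kappa>)"
      by (rule sum_ennreal) (auto simp: prior_weight_def intro!: mult_nonneg_nonneg divide_nonneg_nonneg prod_nonneg)
    also have "\<dots> \<le> 1"
      using sum_prior_weight_le[OF p4] by (simp add: ennreal_le_1)
    finally show ?thesis .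
  qed
  have "AMSE d n \<sigma> Jhat khat a0 f
      \<le> (\<integral>\<^sup>+\<epsilon>. ennreal ((cmod (coef d n \<epsilon> (0, 0)))\<^sup>2) + (ennreal (1 / \<delta> * A)
          + (ennreal (q / \<delta>) * ennreal (S (model J \<kappa>) \<epsilon>)
            + ennreal (1 / (\<delta> * \<tau>)) * (\<Sum>m\<in>models d n. ennreal (X m \<epsilon>)))) \<partial>?P)"
    unfolding AMSE_def
  proof (rule nn_integral_mono, goal_cases)
    case (1 \<epsilon>)
    have "ennreal ((cmod (coef d n \<epsilon> (0, 0)))\<^sup>2) + (ennreal (1 / \<delta> * A)
          + (ennreal (q / \<delta>) * ennreal (S (model J \<kappa>) \<epsilon>)
            + ennreal (1 / (\<delta> * \<tau>)) * (\<Sum>m\<in>models d n. ennreal (X m \<epsilon>))))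
       = ennreal ((cmod (coef d n \<epsilon> (0, 0)))\<^sup>2
        + (1 / \<delta> * A + (q / \<delta> * S (model J \<kappa>) \<epsilon> + 1 / (\<delta> * \<tau>) * (\<Sum>m\<in>models d n. X m \<epsilon>))))"
      using pos A S0 X0
      by (simp only: ennreal_plus ennreal_mult sum_ennreal sum_nonneg add_nonneg_nonneg
          mult_nonneg_nonneg divide_nonneg_nonneg less_imp_le zero_le_power2 zero_le_one)
    with pointwise[of \<epsilon>] show ?case by (simp add: ennreal_leI)
  qed
  also have "\<dots> = (\<integral>\<^sup>+\<epsilon>. ennreal ((cmod (coef d n \<epsilon> (0, 0)))\<^sup>2) \<partial>?P) + (ennreal (1 / \<delta> * A)
      + (ennreal (q / \<delta>) * (\<integral>\<^sup>+\<epsilon>. ennreal (S (model J \<kappa>) \<epsilon>) \<partial>?P)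
        + ennreal (1 / (\<delta> * \<tau>)) * (\<integral>\<^sup>+\<epsilon>. (\<Sum>m\<in>models d n. ennreal (X m \<epsilon>)) \<partial>?P)))"
    by (simp add: nn_integral_add nn_integral_cmult P1 del: ennreal_mult sum_ennreal)
  also have "\<dots> \<le> ennreal (6 * \<sigma>\<^sup>2 / ?N) + (ennreal (1 / \<delta> * A)
      + (ennreal (q / \<delta>) * ennreal (12 * \<sigma>\<^sup>2 / ?N * real (\<Sum>j\<in>J. \<kappa> j)) + ennreal (1 / (\<delta> * \<tau>)) * 1))"
    using noise_model_second_moment[OF s Nn adm]
    by (intro add_mono mult_left_mono I0 IX order_refl) (auto simp: S_def)
  also have "\<dots> = ennreal (6 * \<sigma>\<^sup>2 / ?N + (1 / \<delta> * A
      + (q / \<delta> * (12 * \<sigma>\<^sup>2 / ?N * real (\<Sum>j\<in>J. \<kappa> j)) + 1 / (\<delta> * \<tau>))))"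
    using pos A
    by (simp add: ennreal_plus[symmetric] ennreal_mult[symmetric] sum_nonneg del: ennreal_plus)
  also have "6 * \<sigma>\<^sup>2 / ?N + (1 / \<delta> * A
      + (q / \<delta> * (12 * \<sigma>\<^sup>2 / ?N * real (\<Sum>j\<in>J. \<kappa> j)) + 1 / (\<delta> * \<tau>)))
      = 6 * \<sigma>\<^sup>2 / ?N + 1 / \<delta> * (A + q * (12 * \<sigma>\<^sup>2 / ?N * real (\<Sum>j\<in>J. \<kappa> j))
          + 2 * (1 + \<gamma>) / \<gamma> * (\<sigma>\<^sup>2 / ?N))"
  proof -
    \<comment> \<open>The factor \<open>2 * (1 + \<gamma>) / \<gamma>\<close> is
      \<open>1 / t\<close>.\<close>
    have "1 / (\<delta> * \<tau>) = 1 / \<delta> * (2 * (1 + \<gamma>) / \<gamma> * (\<sigma>\<^sup>2 / ?N))"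
      using g s Nn by (simp add: \<tau>_def t_def)
    moreover have "q / \<delta> * Y = 1 / \<delta> * (q * Y)" for Y by simp
    ultimately show ?thesis by (simp only: distrib_left add.assoc)
  qed
  finally show ?thesis unfolding \<delta>_def q_def A_def .
qed

subsection \<open>The competitor model and the rate\<close>

text \<open>The bound \<open>(e d / k) ^ k\<close>: compare the single term of index
  \<open>k\<close> in the expansion of \<open>(1 + x) ^ d\<close> with \<open>exp (x d)\<close>, at
  the choice \<open>x = k / d\<close>.\<close>

lemma ln_binomial_le:
  assumes k: "0 < k" "k \<le> d"
  shows "ln (real (d choose k)) \<le> real k + real k * ln (real d / real k)"
proof -
  define x where "x = real k / real d"
  have x: "x > 0" using k by (simp add: x_def)
  have "real (d choose k) * x ^ k \<le> (\<Sum>i\<le>d. real (d choose i) * x ^ i)"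
    using k x by (intro member_le_sum[of k "{..d}" "\<lambda>i. real (d choose i) * x ^ i"]) auto
  also have "\<dots> = (1 + x) ^ d"
    using binomial_ring[of x 1 d] by (simp add: add.commute)
  also have "\<dots> \<le> exp x ^ d"
    using x by (intro power_mono exp_ge_add_one_self) simp
  also have "\<dots> = exp (real k)"
    using k by (simp add: exp_of_nat_mult[symmetric] x_def)
  finally have "ln (real (d choose k) * x ^ k) \<le> ln (exp (real k))"
    using k x by (subst ln_le_cancel_iff) auto
  then show ?thesis
    using k x by (simp add: ln_mult ln_realpow x_def ln_div algebra_simps)
qed

text \<open>The cut-point equates the squared bias \<open>k powr (- 2 s)\<close> with the variance \<open>k / N\<close>.\<close>

definition cutpoint :: "nat \<Rightarrow> nat \<Rightarrow> real \<Rightarrow> nat" where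
  "cutpoint N m s = min (nat \<lfloor>real N powr (1 / (2 * s + 1))\<rfloor>) ((m - 1) div 2)"

definition rate :: "nat \<Rightarrow> nat \<Rightarrow> real \<Rightarrow> real" where
  "rate N m s = min (real N powr (- (2 * s) / (2 * s + 1))) (real m / real N)"

text \<open>With \<open>X = N powr (1 / (2 s + 1))\<close> the rate is \<open>min X m / N\<close>
  and \<open>X powr (2 s) = N / X\<close>. Either the cut-point already takes in all frequencies and
  there is no bias, or it is the floor of \<open>X\<close> and the smoothness condition bounds the
  tail by \<open>R\<^sup>2 / X powr (2 s)\<close>.\<close>

lemma
  assumes N: "N > 0" and m: "m \<ge> 3" and s: "s > 0"
  shows cutpoint_range: "cutpoint N m s \<in> {1..(m - 1) div 2}"
    and cutpoint_le_rate: "real (cutpoint N m s) / real N \<le> rate N m s"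
    and inverse_le_rate: "1 / real N \<le> rate N m s"
    and cutpoint_bias: "g \<in> sobolev_class m s R \<Longrightarrow>
      (\<Sum>k | int (cutpoint N m s) < \<bar>k\<bar> \<and> \<bar>k\<bar> \<le> (int m - 1) div 2. (cmod (fourier_coeff m g k))\<^sup>2)
        \<le> R\<^sup>2 * rate N m s"
proof -
  define X where "X = real N powr (1 / (2 * s + 1))"
  define k where "k = cutpoint N m s"
  have X1: "X \<ge> 1" unfolding X_def using N s by (intro ge_one_powr_ge_zero) auto
  have XN: "real N powr (- (2 * s) / (2 * s + 1)) = X / real N"
  proof -
    have "- (2 * s) / (2 * s + 1) = 1 / (2 * s + 1) - 1" using s by (simp add: field_simps)
    then show ?thesis using N by (simp add: X_def powr_diff)
  qed
  have X2s: "X powr (2 * s) = real N / X"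
  proof -
    have "X powr (2 * s) = real N powr (1 - 1 / (2 * s + 1))"
      unfolding X_def powr_powr using s by (intro arg_cong[of _ _ "\<lambda>x. real N powr x"]) (simp add: field_simps)
    then show ?thesis using N by (simp add: X_def powr_diff)
  qed
  have fl: "real (nat \<lfloor>X\<rfloor>) \<le> X" "X < real (nat \<lfloor>X\<rfloor>) + 1" "1 \<le> nat \<lfloor>X\<rfloor>"
    using X1 by linarith+
  have k: "k = min (nat \<lfloor>X\<rfloor>) ((m - 1) div 2)" by (simp add: k_def cutpoint_def X_def)
  show range: "cutpoint N m s \<in> {1..(m - 1) div 2}"
    using fl(3) m unfolding k_def[symmetric] k by auto
  have "real k \<le> X" "real k \<le> real m" using fl(1) unfolding k by linarith+
  then show "real (cutpoint N m s) / real N \<le> rate N m s"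
    unfolding rate_def XN k_def[symmetric] by (auto intro: divide_right_mono)
  show "1 / real N \<le> rate N m s"
    unfolding rate_def XN using X1 m by (auto intro!: divide_right_mono)
  have rate0: "rate N m s \<ge> 0" by (simp add: rate_def)
  assume g: "g \<in> sobolev_class m s R"
  let ?K = "{i. int k < \<bar>i\<bar> \<and> \<bar>i\<bar> \<le> (int m - 1) div 2}"
  show "(\<Sum>i | int (cutpoint N m s) < \<bar>i\<bar> \<and> \<bar>i\<bar> \<le> (int m - 1) div 2. (cmod (fourier_coeff m g i))\<^sup>2)
      \<le> R\<^sup>2 * rate N m s"
    unfolding k_def[symmetric]
  proof (cases "k < (m - 1) div 2")
    case False
    then have empty: "?K = {}" using m by auto
    show "(\<Sum>i\<in>?K. (cmod (fourier_coeff m g i))\<^sup>2) \<le> R\<^sup>2 * rate N m s"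
      unfolding empty using rate0 by simp
  next
    case True
    then have kX: "k = nat \<lfloor>X\<rfloor>" unfolding k by auto
    \<comment> \<open>When the cap is not active, \<open>X\<close> is below \<open>m\<close>, so the
      minimum in the rate is attained at its first entry.\<close>
    have "k + 1 \<le> m" using True by linarith
    then have "X \<le> real m" using fl(2) kX by linarith
    then have rate: "rate N m s = X / real N"
      unfolding rate_def XN by (simp add: divide_right_mono)
    have "real N / X * (\<Sum>i\<in>?K. (cmod (fourier_coeff m g i))\<^sup>2)
        \<le> (\<Sum>i\<in>?K. (cmod (fourier_coeff m g i))\<^sup>2 * real_of_int \<bar>i\<bar> powr (2 * s))"
      unfolding sum_distrib_left X2s[symmetric]
    proof (rule sum_mono)
      fix i assume "i \<in> ?K"
      \<comment> \<open>Strictly beyond the cut-point means at least \<open>k + 1\<close>, which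
        exceeds \<open>X\<close> although \<open>k\<close> itself may lie below it.\<close>
      then have "int k + 1 \<le> \<bar>i\<bar>" by auto
      then have "real_of_int (int k + 1) \<le> real_of_int \<bar>i\<bar>" by (simp only: of_int_le_iff)
      moreover have "X < real k + 1" using fl(2) kX by simp
      ultimately have "X \<le> real_of_int \<bar>i\<bar>" by simp
      then have "X powr (2 * s) \<le> real_of_int \<bar>i\<bar> powr (2 * s)"
        using X1 s by (intro powr_mono2) auto
      then show "X powr (2 * s) * (cmod (fourier_coeff m g i))\<^sup>2
          \<le> (cmod (fourier_coeff m g i))\<^sup>2 * real_of_int \<bar>i\<bar> powr (2 * s)"
        by (subst mult.commute) (intro mult_left_mono, auto)
    qed
    also have "\<dots> \<le> (\<Sum>i | \<bar>i\<bar> \<le> (int m - 1) div 2.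
        (cmod (fourier_coeff m g i))\<^sup>2 * real_of_int \<bar>i\<bar> powr (2 * s))"
      by (rule sum_mono2) auto
    also have "\<dots> \<le> R\<^sup>2" using g by (simp add: sobolev_class_def)
    finally show "(\<Sum>i\<in>?K. (cmod (fourier_coeff m g i))\<^sup>2) \<le> R\<^sup>2 * rate N m s"
      unfolding rate using N X1 by (simp add: field_simps)
  qed
qed

lemma sum_freqs_outside_model:
  "(\<Sum>b\<in>freqs d n - model J \<kappa>. F b)
    = (\<Sum>j=1..d. \<Sum>k | 1 \<le> \<bar>k\<bar> \<and> \<bar>k\<bar> \<le> (int (n j) - 1) div 2.
        if (j, k) \<in> model J \<kappa> then 0 else F (j, k))"
  unfolding sum_freqs[where F = "\<lambda>b. if b \<in> model J \<kappa> then 0 else F b", symmetric]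
  by (rule sum.mono_neutral_cong_left) auto

text \<open>The competitor may contain components outside \<open>J\<close>: their true coefficients
  vanish, so they add no bias whatever their cut-points.\<close>

lemma bias_bound:
  assumes J: "J \<subseteq> {1..d}" "J \<subseteq> J0" and N: "N > 0" and n: "\<And>j. j \<in> {1..d} \<Longrightarrow> n j \<ge> 3"
    and sR: "\<And>j. j \<in> J \<Longrightarrow> s j > 0 \<and> 0 \<le> R j \<and> R j \<le> C"
    and f: "f \<in> sparse_functions d n s R J"
    and \<kappa>: "\<And>j. j \<in> J \<Longrightarrow> \<kappa> j = cutpoint N (n j) (s j)"
  shows "(\<Sum>b\<in>freqs d n - model J0 \<kappa>. (cmod (theta n a0 f b))\<^sup>2)
    \<le> C\<^sup>2 * (\<Sum>j\<in>J. rate N (n j) (s j))"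
proof -
  let ?B = "\<lambda>j. \<Sum>k | 1 \<le> \<bar>k\<bar> \<and> \<bar>k\<bar> \<le> (int (n j) - 1) div 2.
        if (j, k) \<in> model J0 \<kappa> then 0 else (cmod (theta n a0 f (j, k)))\<^sup>2"
  have "(\<Sum>b\<in>freqs d n - model J0 \<kappa>. (cmod (theta n a0 f b))\<^sup>2) = (\<Sum>j=1..d. ?B j)"
    by (rule sum_freqs_outside_model)
  also have "\<dots> = (\<Sum>j\<in>J. ?B j)"
  proof (rule sum.mono_neutral_right[OF _ J(1)])
    show "\<forall>j\<in>{1..d} - J. ?B j = 0"
    proof
      fix j assume j: "j \<in> {1..d} - J"
      then have "f j = (\<lambda>_. 0)" using f by (simp add: sparse_functions_def)
      then have "theta n a0 f (j, k) = 0" for k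
        using j by (simp add: theta_def fourier_coeff_def dft_def)
      then show "?B j = 0" by (intro sum.neutral) simp
    qed
  qed simp
  also have "\<dots> \<le> (\<Sum>j\<in>J. C\<^sup>2 * rate N (n j) (s j))"
  proof (rule sum_mono)
    fix j assume j: "j \<in> J"
    then have j1: "j \<in> {1..d}" "j \<in> J0" "j \<noteq> 0" using J by auto
    have "?B j = (\<Sum>k | int (cutpoint N (n j) (s j)) < \<bar>k\<bar> \<and> \<bar>k\<bar> \<le> (int (n j) - 1) div 2.
        (cmod (fourier_coeff (n j) (f j) k))\<^sup>2)"
      by (rule sum.mono_neutral_cong_right)
        (use j j1 in \<open>auto simp: model_def \<kappa> theta_def\<close>)
    also have "\<dots> \<le> (R j)\<^sup>2 * rate N (n j) (s j)"
      using f j sR[OF j] by (intro cutpoint_bias[OF N n[OF j1(1)]]) (auto simp: sparse_functions_def)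
    also have "\<dots> \<le> C\<^sup>2 * rate N (n j) (s j)"
      using sR[OF j] by (intro mult_right_mono power_mono) (auto simp: rate_def)
    finally show "?B j \<le> C\<^sup>2 * rate N (n j) (s j)" .
  qed
  finally show ?thesis by (simp add: sum_distrib_left)
qed

lemma ln_inverse_mult_le:
  fixes p x b :: real
  assumes "p > 0" "x > 0" "exp (- a) \<le> p"
  shows "ln (inverse p * x) \<le> a + ln x"
proof -
  have "- a \<le> ln p" using assms by (simp add: ln_ge_iff)
  then show ?thesis using assms by (simp add: ln_mult ln_inverse)
qed

text \<open>If \<open>J\<close> is large then only the prior mass at \<open>d\<close> is controlled, so the oracle competitor is the
  full set of components, with the cut-point \<open>1\<close> outside \<open>J\<close>. This costs \<open>d \<le> e |J|\<close> coefficients.\<close>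

lemma competitor:
  fixes C0 :: real
  assumes C0: "C0 > 0" and N: "N > 0" and n: "\<And>j. j \<in> {1..d} \<Longrightarrow> n j \<ge> 3"
    and J: "J \<subseteq> {1..d}" "J \<noteq> {}" and s: "\<And>j. j \<in> J \<Longrightarrow> s j > 0"
    and p0: "\<And>h. h \<le> d \<Longrightarrow> pmf \<pi>0 h > 0"
    and small: "\<forall>h\<in>{1..nat \<lfloor>real d / exp 1\<rfloor>}. pmf \<pi>0 h \<ge> (real h / real d) powr (C0 * real h)"
    and full: "pmf \<pi>0 d \<ge> exp (- C0 * real d)"
  defines "S \<equiv> \<Sum>j\<in>J. rate N (n j) (s j)"
  obtains J0 \<kappa> where "admissible d n J0 \<kappa>" "J \<subseteq> J0"
    "\<And>j. j \<in> J \<Longrightarrow> \<kappa> j = cutpoint N (n j) (s j)"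
    "real (\<Sum>j\<in>J0. \<kappa> j) / real N \<le> 4 * S"
    "ln (inverse (pmf \<pi>0 (card J0)) * real (d choose card J0)) / real N
      \<le> (3 * C0 + 1) * (S + real (card J) * ln (real d / real (card J)) / real N)"
proof -
  define h where "h = card J"
  define L where "L = real h * ln (real d / real h)"
  have fJ: "finite J" using J(1) by (rule finite_subset) simp
  have h: "0 < h" "h \<le> d" using J fJ card_mono[OF _ J(1)] by (auto simp: h_def card_gt_0_iff)
  have L: "L \<ge> 0" unfolding L_def using h by (intro mult_nonneg_nonneg ln_ge_zero) auto
  \<comment> \<open>Each nonzero component costs at least \<open>1 / N\<close> in the rate; this
    absorbs the linear term \<open>h\<close> of the binomial bound.\<close>
  have hS: "real h / real N \<le> S"
  proof -
    have "(\<Sum>j\<in>J. 1 / real N) \<le> S"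
      unfolding S_def using J n s by (intro sum_mono inverse_le_rate N) auto
    then show ?thesis by (simp add: h_def)
  qed
  have cut: "real (\<Sum>j\<in>J. cutpoint N (n j) (s j)) / real N \<le> S"
    unfolding S_def of_nat_sum sum_divide_distrib
    using J n s by (intro sum_mono cutpoint_le_rate N) auto
  \<comment> \<open>The constant \<open>3 * C0 + 1\<close> serves both cases:
    \<open>C0 * L + h + L\<close> for small \<open>h\<close>, and \<open>3 * C0 * h\<close> for
    large \<open>h\<close>.\<close>
  have bound: "P / real N \<le> (3 * C0 + 1) * (S + L / real N)"
    if "P \<le> (3 * C0 + 1) * (real h + L)" for P
  proof -
    have "P / real N \<le> (3 * C0 + 1) * (real h + L) / real N"
      using that by (rule divide_right_mono) simp
    also have "\<dots> = (3 * C0 + 1) * (real h / real N + L / real N)"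
      by (simp only: times_divide_eq_right add_divide_distrib[symmetric])
    also have "\<dots> \<le> (3 * C0 + 1) * (S + L / real N)"
      using C0 hS by (intro mult_left_mono) auto
    finally show ?thesis .
  qed
  have S0: "S \<ge> 0" using hS by (rule order_trans[rotated]) simp
  show thesis
  proof (cases "real h \<le> real d / exp 1")
    case True
    have "h \<in> {1..nat \<lfloor>real d / exp 1\<rfloor>}" using True h by (auto simp: le_nat_floor)
    with small have "(real h / real d) powr (C0 * real h) \<le> pmf \<pi>0 h" by blast
    also have "(real h / real d) powr (C0 * real h) = exp (- (C0 * L))"
      using h by (simp add: powr_def L_def ln_div algebra_simps)
    finally have "ln (inverse (pmf \<pi>0 h) * real (d choose h)) \<le> C0 * L + ln (real (d choose h))"
      using h p0 by (intro ln_inverse_mult_le) auto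
    also have "\<dots> \<le> C0 * L + (real h + L)"
      using ln_binomial_le[OF h] by (simp add: L_def)
    also have "\<dots> \<le> (3 * C0 + 1) * (real h + L)"
      using C0 L by (simp add: algebra_simps)
    finally have "ln (inverse (pmf \<pi>0 h) * real (d choose h)) \<le> (3 * C0 + 1) * (real h + L)" .
    from bound[OF this] show thesis
      using cut S0 J n s
      by (intro that[of J "\<lambda>j. cutpoint N (n j) (s j)"])
        (auto simp: admissible_def h_def L_def simp del: of_nat_sum intro!: cutpoint_range[OF N, simplified])
  next
    case False
    define \<kappa> where "\<kappa> = (\<lambda>j. if j \<in> J then cutpoint N (n j) (s j) else 1)"
    have d3: "real d \<le> 3 * real h"
    proof -
      have "real d < exp 1 * real h" using False by (simp add: field_simps)
      also have "\<dots> \<le> 3 * real h" using exp_le by (intro mult_right_mono) auto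
      finally show ?thesis by simp
    qed
    have "ln (inverse (pmf \<pi>0 d) * real (d choose d)) \<le> C0 * real d + ln (real (d choose d))"
      using full p0 by (intro ln_inverse_mult_le) auto
    also have "\<dots> \<le> C0 * (3 * real h)" using d3 C0 by simp
    also have "\<dots> \<le> (3 * C0 + 1) * (real h + L)"
      using C0 L by (simp add: algebra_simps)
    finally have P: "ln (inverse (pmf \<pi>0 d) * real (d choose d)) \<le> (3 * C0 + 1) * (real h + L)" .
    \<comment> \<open>The 4 is \<open>3 + 1\<close>: at most \<open>3 * h\<close> unit cut-points
      outside \<open>J\<close>, as \<open>d \<le> 3 * h\<close>, and the balanced cut-points
      inside.\<close>
    have "real (\<Sum>j=1..d. \<kappa> j) / real N \<le> 4 * S"
    proof -
      have "(\<Sum>j=1..d. \<kappa> j) = (\<Sum>j\<in>{1..d} - J. \<kappa> j) + (\<Sum>j\<in>J. \<kappa> j)"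
        using J(1) by (intro sum.subset_diff) auto
      also have "(\<Sum>j\<in>{1..d} - J. \<kappa> j) = d - h"
        using J(1) fJ by (simp add: \<kappa>_def card_Diff_subset h_def)
      also have "(\<Sum>j\<in>J. \<kappa> j) = (\<Sum>j\<in>J. cutpoint N (n j) (s j))"
        by (simp add: \<kappa>_def)
      finally have "real (\<Sum>j=1..d. \<kappa> j) \<le> 3 * real h + real (\<Sum>j\<in>J. cutpoint N (n j) (s j))"
        using d3 by (simp del: of_nat_sum)
      then have "real (\<Sum>j=1..d. \<kappa> j) / real N
          \<le> 3 * (real h / real N) + real (\<Sum>j\<in>J. cutpoint N (n j) (s j)) / real N"
        by (simp add: divide_right_mono add_divide_distrib[symmetric] del: of_nat_sum)
      with hS cut show ?thesis by linarith
    qed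
    moreover have "admissible d n {1..d} \<kappa>"
      unfolding admissible_def
    proof (intro conjI ballI order_refl)
      fix j assume j: "j \<in> {1..d}"
      have "3 \<le> n j" by (rule n[OF j])
      then show "\<kappa> j \<in> {1..(n j - 1) div 2}"
        using cutpoint_range[OF N n[OF j] s] by (auto simp: \<kappa>_def)
    qed
    ultimately show thesis
      using bound[OF P] J(1) by (intro that[of "{1..d}" \<kappa>]) (auto simp: \<kappa>_def h_def L_def)
  qed
qed

text \<open>The lower bound on the cut-point priors makes each component penalty at most linear in
  its cut-point, hence of the same order as the variance.\<close>

lemma model_pen_le:
  assumes g: "\<gamma> > 0" and adm: "admissible d n J \<kappa>"
    and p: "\<And>j k. j \<in> {1..d} \<Longrightarrow> k \<in> {1..(n j - 1) div 2} \<Longrightarrow>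
      pmf (\<pi> j) k > 0 \<and> exp (- C1 * real k) \<le> pmf (\<pi> j) k"
  shows "model_pen d n \<sigma> \<gamma> \<pi>0 \<pi> J \<kappa>
    \<le> 2 * \<sigma>\<^sup>2 * (1 + 1 / \<gamma>) *
      ((C1 + ln (1 + \<gamma>)) * (real (\<Sum>j\<in>J. \<kappa> j) / real (sample_size d n))
        + ln (inverse (pmf \<pi>0 (card J)) * real (d choose card J)) / real (sample_size d n))"
proof -
  let ?N = "real (sample_size d n)"
  define w where "w = 2 * \<sigma>\<^sup>2 / ?N * (1 + 1 / \<gamma>)"
  have w: "w \<ge> 0" using g by (simp add: w_def)
  have "ln (inverse (pmf (\<pi> j) (\<kappa> j)) * (1 + \<gamma>) ^ \<kappa> j) \<le> (C1 + ln (1 + \<gamma>)) * real (\<kappa> j)"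
    if "j \<in> J" for j
  proof -
    have "j \<in> {1..d}" "\<kappa> j \<in> {1..(n j - 1) div 2}" using adm that by (auto simp: admissible_def)
    from p[OF this] have "ln (inverse (pmf (\<pi> j) (\<kappa> j)) * (1 + \<gamma>) ^ \<kappa> j)
        \<le> C1 * real (\<kappa> j) + ln ((1 + \<gamma>) ^ \<kappa> j)"
      using g by (intro ln_inverse_mult_le) auto
    then show ?thesis using g by (simp add: ln_realpow algebra_simps)
  qed
  then have "(\<Sum>j\<in>J. w * ln (inverse (pmf (\<pi> j) (\<kappa> j)) * (1 + \<gamma>) ^ \<kappa> j))
      \<le> (\<Sum>j\<in>J. w * ((C1 + ln (1 + \<gamma>)) * real (\<kappa> j)))"
    using w by (intro sum_mono mult_left_mono)
  also have "\<dots> = w * ((C1 + ln (1 + \<gamma>)) * real (\<Sum>j\<in>J. \<kappa> j))"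
    by (simp add: sum_distrib_left)
  finally have "model_pen d n \<sigma> \<gamma> \<pi>0 \<pi> J \<kappa> \<le> w * ((C1 + ln (1 + \<gamma>)) * real (\<Sum>j\<in>J. \<kappa> j))
      + w * ln (inverse (pmf \<pi>0 (card J)) * real (d choose card J))"
    unfolding model_pen_def Penj_def Pen0_def w_def[symmetric] by simp
  moreover have "w * (a * x) + w * b = 2 * \<sigma>\<^sup>2 * (1 + 1 / \<gamma>) * (a * (x / ?N) + b / ?N)" for a b x
  proof -
    define W where "W = 2 * \<sigma>\<^sup>2 * (1 + 1 / \<gamma>)"
    have "w = W / ?N" by (simp add: w_def W_def)
    then show ?thesis unfolding W_def[symmetric] by (simp add: distrib_left)
  qed
  ultimately show ?thesis by (simp only:)
qed

text \<open>In order: error of the constant, bias, penalty, noise energy of the competitor, cost of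
  selection. The factor 4 bounds the total cut-point (so \<open>48 = 12 * 4\<close>), and the 2
  comes from replacing a sum of two terms by their maximum.\<close>

definition risk_const :: "real \<Rightarrow> real \<Rightarrow> real \<Rightarrow> real \<Rightarrow> real \<Rightarrow> real" where
  "risk_const \<sigma> C0 C1 CR \<gamma> = 6 * \<sigma>\<^sup>2 + 1 / min (1 / 2) (1 / (4 * \<gamma>)) *
    ((1 + 4 * \<gamma>) * CR\<^sup>2
      + 2 * \<sigma>\<^sup>2 * (1 + 1 / \<gamma>) * ((C1 + ln (1 + \<gamma>)) * 4 + (3 * C0 + 1) * 2)
      + (1 + 1 / (2 * \<gamma>)) * (48 * \<sigma>\<^sup>2)
      + 2 * (1 + \<gamma>) / \<gamma> * \<sigma>\<^sup>2)"

lemma AMSE_le_rate: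
  fixes \<sigma> \<gamma> C0 C1 CR a0 :: real and n :: "nat \<Rightarrow> nat"
  assumes s: "\<sigma> > 0" and g: "\<gamma> > 0" and C0: "C0 > 0" and C1: "C1 > 0"
    and n: "\<And>j. j \<in> {1..d} \<Longrightarrow> odd (n j) \<and> n j \<ge> 3"
    and p0: "\<And>h. h \<le> d \<Longrightarrow> pmf \<pi>0 h > 0"
    and small: "\<forall>h\<in>{1..nat \<lfloor>real d / exp 1\<rfloor>}. pmf \<pi>0 h \<ge> (real h / real d) powr (C0 * real h)"
    and full: "pmf \<pi>0 d \<ge> exp (- C0 * real d)"
    and p: "\<And>j k. j \<in> {1..d} \<Longrightarrow> k \<in> {1..(n j - 1) div 2} \<Longrightarrow>
      pmf (\<pi> j) k > 0 \<and> exp (- C1 * real k) \<le> pmf (\<pi> j) k"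
    and p4: "\<And>j k. j \<in> {1..d} \<Longrightarrow> k \<in> {1..(n j - 1) div 2} \<Longrightarrow> pmf (\<pi> j) k \<le> (1 / 4) ^ k"
    and MAP: "MAP_selection d n \<sigma> \<gamma> \<pi>0 \<pi> Jhat khat"
    and J: "J \<subseteq> {1..d}" "J \<noteq> {}"
    and sR: "\<And>j. j \<in> J \<Longrightarrow> s j > 0 \<and> 0 \<le> R j \<and> R j \<le> CR"
    and f: "f \<in> sparse_functions d n s R J"
  shows "AMSE d n \<sigma> Jhat khat a0 f
    \<le> ennreal (risk_const \<sigma> C0 C1 CR \<gamma> * max (\<Sum>j\<in>J. rate (sample_size d n) (n j) (s j))
        (real (card J) * ln (real d / real (card J)) / real (sample_size d n)))"
proof -
  let ?N = "real (sample_size d n)"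
  define S where "S = (\<Sum>j\<in>J. rate (sample_size d n) (n j) (s j))"
  define L where "L = real (card J) * ln (real d / real (card J)) / ?N"
  define Mx where "Mx = max S L"
  have N: "sample_size d n > 0" by (rule sample_size_pos) (use n odd_pos in blast)
  have c0: "fourier_coeff (n j) (f j) 0 = 0" if "j \<in> {1..d}" for j
    using f that by (cases "j \<in> J")
      (auto simp: sparse_functions_def sobolev_class_def fourier_coeff_def dft_def)
  obtain J0 \<kappa> where adm: "admissible d n J0 \<kappa>" and sub: "J \<subseteq> J0"
    and \<kappa>: "\<And>j. j \<in> J \<Longrightarrow> \<kappa> j = cutpoint (sample_size d n) (n j) (s j)"
    and K: "real (\<Sum>j\<in>J0. \<kappa> j) / ?N \<le> 4 * S"
    and P: "ln (inverse (pmf \<pi>0 (card J0)) * real (d choose card J0)) / ?N \<le> (3 * C0 + 1) * (S + L)"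
    using competitor[OF C0 N _ J _ p0 small full, of n s] n sR unfolding S_def L_def by blast
  have SM: "S \<le> Mx" "L \<le> Mx" by (auto simp: Mx_def)
  \<comment> \<open>As \<open>J\<close> is nonempty, the maximum is at least \<open>1 / N\<close>,
    which absorbs the error of the constant and the cost of selection.\<close>
  have N1: "1 / ?N \<le> Mx"
  proof -
    obtain j where j: "j \<in> J" using J(2) by blast
    have "1 / ?N \<le> rate (sample_size d n) (n j) (s j)"
      using j J(1) n sR by (intro inverse_le_rate N) auto
    also have "\<dots> \<le> S" unfolding S_def
      using j J(1) by (intro member_le_sum) (auto simp: rate_def intro: finite_subset)
    finally show ?thesis using SM(1) by simp
  qed
  have lng: "ln (1 + \<gamma>) \<ge> 0" using g by simp
  have K': "real (\<Sum>j\<in>J0. \<kappa> j) / ?N \<le> 4 * Mx" using K SM by linarith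
  have P': "ln (inverse (pmf \<pi>0 (card J0)) * real (d choose card J0)) / ?N \<le> (3 * C0 + 1) * (2 * Mx)"
    by (rule order_trans[OF P mult_left_mono]) (use SM C0 in auto)
  have bias: "(\<Sum>b\<in>freqs d n - model J0 \<kappa>. (cmod (theta n a0 f b))\<^sup>2) \<le> CR\<^sup>2 * Mx"
    by (rule order_trans[OF bias_bound[OF J(1) sub N _ sR f \<kappa>]])
      (use n SM in \<open>auto simp: S_def[symmetric] intro: mult_left_mono\<close>)
  have pen: "model_pen d n \<sigma> \<gamma> \<pi>0 \<pi> J0 \<kappa>
      \<le> 2 * \<sigma>\<^sup>2 * (1 + 1 / \<gamma>) * ((C1 + ln (1 + \<gamma>)) * (4 * Mx) + (3 * C0 + 1) * (2 * Mx))"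
    by (rule order_trans[OF model_pen_le[OF g adm p]], assumption+,
        intro mult_left_mono add_mono K' P') (use g C1 lng in auto)
  have var: "12 * \<sigma>\<^sup>2 / ?N * real (\<Sum>j\<in>J0. \<kappa> j) \<le> 48 * \<sigma>\<^sup>2 * Mx"
  proof -
    have "12 * \<sigma>\<^sup>2 * (real (\<Sum>j\<in>J0. \<kappa> j) / ?N) \<le> 12 * \<sigma>\<^sup>2 * (4 * Mx)"
      by (rule mult_left_mono[OF K']) simp
    then show ?thesis by (simp del: of_nat_sum)
  qed
  have noise: "\<sigma>\<^sup>2 / ?N \<le> \<sigma>\<^sup>2 * Mx"
    using mult_left_mono[OF N1, of "\<sigma>\<^sup>2"] by simp
  have "AMSE d n \<sigma> Jhat khat a0 f
    \<le> ennreal (6 * \<sigma>\<^sup>2 / ?N + 1 / min (1 / 2) (1 / (4 * \<gamma>)) *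
        ((1 + 4 * \<gamma>) * (\<Sum>b\<in>freqs d n - model J0 \<kappa>. (cmod (theta n a0 f b))\<^sup>2)
          + model_pen d n \<sigma> \<gamma> \<pi>0 \<pi> J0 \<kappa>
          + (1 + 1 / (2 * \<gamma>)) * (12 * \<sigma>\<^sup>2 / ?N * real (\<Sum>j\<in>J0. \<kappa> j))
          + 2 * (1 + \<gamma>) / \<gamma> * (\<sigma>\<^sup>2 / ?N)))"
    by (rule oracle_inequality[OF s g _ c0 p0 _ p4 MAP adm]) (use n p in auto)
  also have "\<dots> \<le> ennreal (6 * (\<sigma>\<^sup>2 * Mx) + 1 / min (1 / 2) (1 / (4 * \<gamma>)) *
        ((1 + 4 * \<gamma>) * (CR\<^sup>2 * Mx)
          + 2 * \<sigma>\<^sup>2 * (1 + 1 / \<gamma>) * ((C1 + ln (1 + \<gamma>)) * (4 * Mx) + (3 * C0 + 1) * (2 * Mx))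
          + (1 + 1 / (2 * \<gamma>)) * (48 * \<sigma>\<^sup>2 * Mx)
          + 2 * (1 + \<gamma>) / \<gamma> * (\<sigma>\<^sup>2 * Mx)))"
    using noise g
    by (intro ennreal_leI add_mono mult_left_mono bias pen var noise) auto
  also have "6 * (\<sigma>\<^sup>2 * Mx) + 1 / min (1 / 2) (1 / (4 * \<gamma>)) *
        ((1 + 4 * \<gamma>) * (CR\<^sup>2 * Mx)
          + 2 * \<sigma>\<^sup>2 * (1 + 1 / \<gamma>) * ((C1 + ln (1 + \<gamma>)) * (4 * Mx) + (3 * C0 + 1) * (2 * Mx))
          + (1 + 1 / (2 * \<gamma>)) * (48 * \<sigma>\<^sup>2 * Mx)
          + 2 * (1 + \<gamma>) / \<gamma> * (\<sigma>\<^sup>2 * Mx))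
      = risk_const \<sigma> C0 C1 CR \<gamma> * Mx"
    unfolding risk_const_def by (simp only: distrib_left distrib_right mult.assoc)
  finally show ?thesis unfolding Mx_def S_def L_def .
qed

text \<open>The witness is \<open>risk_const\<close> with its first four arguments fixed. The bound
  for a single \<open>f\<close> involves \<open>f\<close> only through the classes, whose radii lie
  below \<open>C\<^sub>R\<close>, so it passes to the supremum.\<close>

theorem theorem1:
  fixes \<sigma> C\<^sub>0 C\<^sub>1 C\<^sub>R :: real
  assumes "\<sigma> > 0" and "C\<^sub>0 > 0" and "C\<^sub>1 > 0" and "C\<^sub>R > 0"
  shows "\<exists>C :: real \<Rightarrow> real. \<forall>\<gamma>>0.
    \<forall>(d :: nat) (n :: nat \<Rightarrow> nat) (\<pi>\<^sub>0 :: nat pmf) (\<pi> :: nat \<Rightarrow> nat pmf)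
     (Jhat :: ((nat \<Rightarrow> nat) \<Rightarrow> real) \<Rightarrow> nat set) (khat :: ((nat \<Rightarrow> nat) \<Rightarrow> real) \<Rightarrow> nat \<Rightarrow> nat)
     (J :: nat set) (s :: nat \<Rightarrow> real) (R :: nat \<Rightarrow> real) (a\<^sub>0 :: real).
      (\<forall>j\<in>{1..d}. odd (n j) \<and> n j \<ge> 3) \<longrightarrow>
      set_pmf \<pi>\<^sub>0 = {0..d} \<longrightarrow>
      (\<forall>j\<in>{1..d}. cutpoint_prior (n j) (\<pi> j)) \<longrightarrow>
      (\<forall>h\<in>{1..nat \<lfloor>real d / exp 1\<rfloor>}. pmf \<pi>\<^sub>0 h \<ge> (real h / real d) powr (C\<^sub>0 * real h)) \<longrightarrow>
      pmf \<pi>\<^sub>0 d \<ge> exp (- C\<^sub>0 * real d) \<longrightarrow>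
      (\<forall>j\<in>{1..d}. \<forall>k\<in>{1..(n j - 1) div 2}.
         exp (- C\<^sub>1 * real k) \<le> pmf (\<pi> j) k \<and>
         pmf (\<pi> j) k \<le> exp (- (8 * (\<gamma> + 3 / 4)\<^sup>2) * real k)) \<longrightarrow>
      MAP_selection d n \<sigma> \<gamma> \<pi>\<^sub>0 \<pi> Jhat khat \<longrightarrow>
      J \<subseteq> {1..d} \<longrightarrow> J \<noteq> {} \<longrightarrow>
      (\<forall>j\<in>J. s j > 1 / 2 \<and> 0 \<le> R j \<and> R j < C\<^sub>R) \<longrightarrow>
      (SUP f\<in>sparse_functions d n s R J. AMSE d n \<sigma> Jhat khat a\<^sub>0 f)
        \<le> ennreal (C \<gamma> * max
            (\<Sum>j\<in>J. min (real (sample_size d n) powr (- (2 * s j) / (2 * s j + 1)))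
                       (real (n j) / real (sample_size d n)))
            (real (card J) * ln (real d / real (card J)) / real (sample_size d n)))"
proof (intro exI[of _ "risk_const \<sigma> C\<^sub>0 C\<^sub>1 C\<^sub>R"] allI impI SUP_least, goal_cases)
  case (1 \<gamma> d n \<pi>\<^sub>0 \<pi> Jhat khat J s R a\<^sub>0 f)
  note H = this
  have p4: "pmf (\<pi> j) k \<le> (1 / 4) ^ k" if "j \<in> {1..d}" "k \<in> {1..(n j - 1) div 2}" for j k
  proof -
    let ?c = "8 * (\<gamma> + 3 / 4)\<^sup>2"
    \<comment> \<open>Since \<open>\<gamma> > 0\<close>, the decay constant is at least
      \<open>9 / 2\<close>; already 3 suffices, because
      \<open>exp c \<ge> 1 + c \<ge> 4\<close>.\<close>
    have "(3 / 4)\<^sup>2 \<le> (\<gamma> + 3 / 4)\<^sup>2" using H(1) by (intro power_mono) auto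
    then have "3 \<le> ?c" by (simp add: power2_eq_square)
    then have "4 \<le> exp ?c" using exp_ge_add_one_self[of ?c] by linarith
    then have c: "exp (- ?c) \<le> 1 / 4" by (simp add: exp_minus field_simps)
    have "pmf (\<pi> j) k \<le> exp (- ?c * real k)" using H(7) that by blast
    also have "\<dots> = exp (- ?c) ^ k" by (simp add: exp_of_nat_mult[symmetric] mult.commute)
    also have "\<dots> \<le> (1 / 4) ^ k" by (intro power_mono c) simp
    finally show ?thesis .
  qed
  have p: "pmf (\<pi> j) k > 0 \<and> exp (- C\<^sub>1 * real k) \<le> pmf (\<pi> j) k"
    if "j \<in> {1..d}" "k \<in> {1..(n j - 1) div 2}" for j k
    using H(4,7) that unfolding cutpoint_prior_def by blast
  have p0: "pmf \<pi>\<^sub>0 h > 0" if "h \<le> d" for h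
    using H(3) that by (simp add: pmf_positive_iff)
  have n: "odd (n j) \<and> 3 \<le> n j" if "j \<in> {1..d}" for j
    using H(2) that by blast
  have sR: "s j > 0 \<and> 0 \<le> R j \<and> R j \<le> C\<^sub>R" if "j \<in> J" for j
    using H(11) that by force
  show ?case
    using AMSE_le_rate[where d = d and n = n and ?\<pi>0.0 = \<pi>\<^sub>0 and \<pi> = \<pi> and J = J and s = s and R = R,
        OF assms(1) H(1) assms(2,3) n p0 H(5,6) p p4 H(8-10) sR H(12)]
    by (simp only: rate_def)
qed

end
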